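(* Let $M$ be a loopless matroid on $[n]$. The Feichtner--Yuzvinsky Chow ring $D(\widetilde{\mathcal{L}}(M),\widetilde{\mathcal{G}})$ (with coefficients in $\mathbb{Q}$) is isomorphic, as a $\mathbb{Q}$-algebra, to the augmented Chow ring $\widetilde{A}(M)$.
   Context: $M$ has ground set $[n]=\{1,\dots,n\}$, lattice of flats $\mathcal{L}(M)$ (ordered by inclusion), collection of independent sets $\mathcal{I}(M)$, and closure operator $\mathsf{cl}_M$. Poset $\widetilde{\mathcal{L}}(M)$: as a set it is the disjoint union $\mathcal{I}(M)\uplus\mathcal{L}(M)$, where a flat $F\in\mathcal{L}(M)$ is written $F_*$. The order is generated by inclusion inside $\mathcal{I}(M)$, inclusion inside $\mathcal{L}(M)$, and the cover relations $I\lessdot\mathsf{cl}_M(I)_*$ for $I\in\mathcal{I}(M)$ (so $I\le F_*$ iff $I\subseteq F$). It is a graded atomic lattice with minimum $\emptyset\in\mathcal{I}(M)$; its atoms are $\{1\},\dots,\{n\}$ and $\emptyset_*$. The building set is $\widetilde{\mathcal{G}}=\{\{1\},\dots,\{n\}\}\cup\{F_*\}_{F\in\mathcal{L}(M)}$. For an atomic lattice $\mathcal{L}$ with minimum $\hat0$ and subset $\mathcal G\subseteq\mathcal L\setminus\{\hat0\}$: $\mathcal G$ is a building set if for every $X\ne\hat0$, writing $\{G_1,\dots,G_k\}$ for the set of maximal elements of $\{G\in\mathcal G:G\le X\}$, there is a poset isomorphism $\prod_{i}[\hat0,G_i]\to[\hat0,X]$ sending $(\hat0,\dots,G_i,\dots,\hat0)$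 to $G_i$ for each $i$. A subset $N\subseteq\mathcal G$ is nested if for any pairwise incomparable $G_1,\dots,G_t\in N$ with $t\ge2$ the join $G_1\vee\cdots\vee G_t\notin\mathcal G$; $\mathcal N(\mathcal L,\mathcal G)$ is the simplicial complex of nested sets. The Feichtner--Yuzvinsky Chow ring (over $\mathbb{Q}$) is $$D(\mathcal L,\mathcal G)=\mathbb{Q}[x_G]_{G\in\mathcal G}\Big/\Big(\big\langle\textstyle\prod_{i=1}^tx_{G_i}:\{G_1,\dots,G_t\}\notin\mathcal N(\mathcal L,\mathcal G)\big\rangle+\big\langle\textstyle\sum_{G\ge H}x_G: H\text{ an atom of }\mathcal L\big\rangle\Big).$$ The augmented Chow ring is $$\widetilde A(M)=\mathbb{Q}\big[\{x_F\}_{F\in\mathcal L(M)\setminus\{[n]\}}\cup\{y_1,\dots,y_n\}\big]/(I_1+I_2+I_3),$$ with $I_1=\langle x_Fx_G:F,G\text{ incomparable in }\mathcal L(M)\rangle$, $I_2=\langle y_ix_F:i\notin F\rangle$, $I_3=\langle y_i-\sum_{F\in\mathcal{L}(M)\setminus\{[n]\},\,i\notin F}x_F:1\le i\le n\rangle$. *)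

theory Defs
  imports
    Complex_Main
    "HOL-Algebra.Complete_Lattice"
    "HOL-Algebra.QuotRing"
    "HOL-Algebra.Module"
    "HOL-Library.Poly_Mapping"
begin

section \<open>Matroids\<close>

locale matroid =
  fixes E :: "'a set" and Ind :: "'a set set"
  assumes finite_ground: "finite E"
    and indep_subset_ground: "I \<in> Ind \<Longrightarrow> I \<subseteq> E"
    and indep_empty: "{} \<in> Ind"
    and indep_subset: "I \<in> Ind \<Longrightarrow> J \<subseteq> I \<Longrightarrow> J \<in> Ind"
    and indep_augment:
      "I \<in> Ind \<Longrightarrow> J \<in> Ind \<Longrightarrow> card I < card J \<Longrightarrow> \<exists>x\<in>J - I. insert x I \<in> Ind"

definition loopless :: "'a set \<Rightarrow> 'a set set \<Rightarrow> bool" where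
  "loopless E Ind \<longleftrightarrow> (\<forall>i\<in>E. {i} \<in> Ind)"

definition mrank :: "'a set set \<Rightarrow> 'a set \<Rightarrow> nat" where
  "mrank Ind A = Max (card ` {I \<in> Ind. I \<subseteq> A})"

definition mcl :: "'a set \<Rightarrow> 'a set set \<Rightarrow> 'a set \<Rightarrow> 'a set" where
  "mcl E Ind A = {x \<in> E. mrank Ind (insert x A) = mrank Ind A}"

definition flats :: "'a set \<Rightarrow> 'a set set \<Rightarrow> 'a set set" where
  "flats E Ind = {F. F \<subseteq> E \<and> mcl E Ind F = F}"

context matroid
begin

lemma finite_indep: "finite Ind"
  using finite_ground indep_subset_ground
  by (metis PowI finite_Pow_iff finite_subset subsetI)

lemma finite_indep_mem: "I \<in> Ind \<Longrightarrow> finite I"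
  using finite_ground indep_subset_ground finite_subset by metis

lemma card_le_mrank: "I \<in> Ind \<Longrightarrow> I \<subseteq> A \<Longrightarrow> card I \<le> mrank Ind A"
  unfolding mrank_def using finite_indep by (intro Max_ge) auto

lemma mrank_witness: obtains I where "I \<in> Ind" "I \<subseteq> A" "card I = mrank Ind A"
proof -
  have "mrank Ind A \<in> card ` {I \<in> Ind. I \<subseteq> A}"
    unfolding mrank_def using finite_indep indep_empty by (intro Max_in) auto
  then show thesis using that by auto
qed

lemma mrank_mono: "A \<subseteq> B \<Longrightarrow> mrank Ind A \<le> mrank Ind B"
  by (metis card_le_mrank mrank_witness order_trans)

lemma extend_to_basis:
  assumes "J \<in> Ind" "J \<subseteq> A"
  obtains K where "K \<in> Ind" "J \<subseteq> K" "K \<subseteq> A" "card K = mrank Ind A"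
proof -
  have "\<exists>K\<in>Ind. J \<subseteq> K \<and> K \<subseteq> A \<and> card K = mrank Ind A"
    using assms
  proof (induction "mrank Ind A - card J" arbitrary: J rule: less_induct)
    case less
    show ?case
    proof (cases "card J < mrank Ind A")
      case False
      then show ?thesis
        using less.prems card_le_mrank[of J A] by (intro bexI[of _ J]) auto
    next
      case True
      obtain B where B: "B \<in> Ind" "B \<subseteq> A" "card B = mrank Ind A" by (rule mrank_witness)
      with True obtain x where x: "x \<in> B - J" "insert x J \<in> Ind"
        using indep_augment[of J B] less.prems by auto
      then have "card (insert x J) = Suc (card J)"
        using finite_indep_mem less.prems by auto
      then have "mrank Ind A - card (insert x J) < mrank Ind A - card J" using True by simp
      moreover have "insert x J \<subseteq> A" using x B less.prems by auto
      ultimately have "\<exists>K\<in>Ind. insert x J \<subseteq> K \<and> K \<subseteq> A \<and> card K = mrank Ind A"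
        using x by (intro less.hyps) auto
      then show ?thesis by blast
    qed
  qed
  then show thesis using that by blast
qed

lemma mcl_subset: "mcl E Ind A \<subseteq> E"
  by (auto simp: mcl_def)

lemma subset_mcl: "A \<subseteq> E \<Longrightarrow> A \<subseteq> mcl E Ind A"
  by (auto simp: mcl_def insert_absorb)

lemma mcl_mono:
  assumes "A \<subseteq> B"
  shows "mcl E Ind A \<subseteq> mcl E Ind B"
proof
  fix x assume x: "x \<in> mcl E Ind A"
  show "x \<in> mcl E Ind B"
  proof (rule ccontr)
    assume "x \<notin> mcl E Ind B"
    with x have "mrank Ind (insert x B) \<noteq> mrank Ind B" by (auto simp: mcl_def)
    then have less: "mrank Ind B < mrank Ind (insert x B)"
      using mrank_mono[OF subset_insertI[of B x]] by linarith
    obtain J where J: "J \<in> Ind" "J \<subseteq> A" "card J = mrank Ind A" by (rule mrank_witness)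
    then have "J \<subseteq> B" using assms by auto
    with J(1) obtain K where K: "K \<in> Ind" "J \<subseteq> K" "K \<subseteq> B" "card K = mrank Ind B"
      by (rule extend_to_basis)
    have "K \<subseteq> insert x B" using K by auto
    with K(1) obtain L where L: "L \<in> Ind" "K \<subseteq> L" "L \<subseteq> insert x B"
      "card L = mrank Ind (insert x B)"
      by (rule extend_to_basis)
    have "x \<in> L"
      using L less card_le_mrank[of L B] by auto
    have "x \<notin> K"
    proof
      assume "x \<in> K"
      then have "insert x B = B" using K by auto
      with less show False by simp
    qed
    have "insert x J \<in> Ind" using indep_subset[OF L(1)] \<open>x \<in> L\<close> K L by auto
    moreover have "card (insert x J) = Suc (mrank Ind A)"
      using J K \<open>x \<notin> K\<close> finite_indep_mem by (subst card_insert_disjoint) auto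
    ultimately have "Suc (mrank Ind A) \<le> mrank Ind (insert x A)"
      using card_le_mrank[of "insert x J" "insert x A"] J by auto
    with x show False by (auto simp: mcl_def)
  qed
qed

lemma mrank_mcl:
  assumes "A \<subseteq> E"
  shows "mrank Ind (mcl E Ind A) = mrank Ind A"
proof (rule ccontr)
  assume "mrank Ind (mcl E Ind A) \<noteq> mrank Ind A"
  then have less: "mrank Ind A < mrank Ind (mcl E Ind A)"
    using mrank_mono[OF subset_mcl[OF assms]] by auto
  obtain J where J: "J \<in> Ind" "J \<subseteq> A" "card J = mrank Ind A" by (rule mrank_witness)
  obtain K where K: "K \<in> Ind" "K \<subseteq> mcl E Ind A" "card K = mrank Ind (mcl E Ind A)"
    by (rule mrank_witness)
  obtain y where y: "y \<in> K - J" "insert y J \<in> Ind"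
    using indep_augment[OF J(1) K(1)] less J K by auto
  have "Suc (mrank Ind A) \<le> mrank Ind (insert y A)"
    using card_le_mrank[of "insert y J" "insert y A"] y J finite_indep_mem[OF J(1)] by auto
  with y K show False by (auto simp: mcl_def)
qed

lemma mcl_idem:
  assumes "A \<subseteq> E"
  shows "mcl E Ind (mcl E Ind A) = mcl E Ind A"
proof
  show "mcl E Ind (mcl E Ind A) \<subseteq> mcl E Ind A"
  proof
    fix x assume x: "x \<in> mcl E Ind (mcl E Ind A)"
    then have "mrank Ind (insert x (mcl E Ind A)) = mrank Ind A"
      using mrank_mcl[OF assms] by (simp add: mcl_def)
    moreover have "mrank Ind (insert x A) \<le> mrank Ind (insert x (mcl E Ind A))"
      using subset_mcl[OF assms] by (intro mrank_mono) auto
    moreover have "mrank Ind A \<le> mrank Ind (insert x A)" by (intro mrank_mono) auto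
    ultimately show "x \<in> mcl E Ind A" using x by (auto simp: mcl_def)
  qed
qed (rule subset_mcl[OF mcl_subset])

lemma mcl_in_flats: "A \<subseteq> E \<Longrightarrow> mcl E Ind A \<in> flats E Ind"
  using mcl_idem mcl_subset by (simp add: flats_def)

lemma mcl_least: "A \<subseteq> F \<Longrightarrow> F \<in> flats E Ind \<Longrightarrow> mcl E Ind A \<subseteq> F"
  using mcl_mono[of A F] by (auto simp: flats_def)

lemma ground_in_flats: "E \<in> flats E Ind"
  using subset_mcl[of E] mcl_subset[of E] by (auto simp: flats_def)

lemma Inter_in_flats:
  assumes "\<F> \<subseteq> flats E Ind"
  shows "E \<inter> \<Inter>\<F> \<in> flats E Ind"
proof -
  have "mcl E Ind (E \<inter> \<Inter>\<F>) \<subseteq> F" if "F \<in> \<F>" for F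
    using that assms by (intro mcl_least) auto
  then show ?thesis
    using mcl_subset subset_mcl[of "E \<inter> \<Inter>\<F>"] by (auto simp: flats_def)
qed

lemma finite_flats: "finite (flats E Ind)"
  using finite_ground by (auto intro: finite_subset[of _ "Pow E"] simp: flats_def)

lemma empty_in_flats:
  assumes "loopless E Ind"
  shows "{} \<in> flats E Ind"
proof -
  have "mrank Ind {} = 0"
    by (metis card.empty mrank_witness subset_empty)
  moreover have "mrank Ind {i} \<ge> 1" if "i \<in> E" for i
    using card_le_mrank[of "{i}" "{i}"] that assms by (auto simp: loopless_def)
  ultimately show ?thesis by (force simp: flats_def mcl_def)
qed

end


section \<open>Building sets and nested sets\<close>

definition atoms :: "('a, 'b) gorder_scheme \<Rightarrow> 'a set" where
  "atoms L = {H \<in> carrier L. H \<noteq> \<bottom>\<^bsub>L\<^esub> \<and>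
     (\<forall>x\<in>carrier L. x \<sqsubseteq>\<^bsub>L\<^esub> H \<longrightarrow> x = \<bottom>\<^bsub>L\<^esub> \<or> x = H)}"

definition atomic_lattice :: "('a, 'b) gorder_scheme \<Rightarrow> bool" where
  "atomic_lattice L \<longleftrightarrow> lattice L \<and>
     (\<exists>z. least L z (carrier L)) \<and>
     (\<forall>x\<in>carrier L. least L x (Upper L {H \<in> atoms L. H \<sqsubseteq>\<^bsub>L\<^esub> x}))"

definition max_below :: "('a, 'b) gorder_scheme \<Rightarrow> 'a set \<Rightarrow> 'a \<Rightarrow> 'a set" where
  "max_below L \<G> X = {G \<in> \<G>. G \<sqsubseteq>\<^bsub>L\<^esub> X \<and>
     (\<forall>G'\<in>\<G>. G' \<sqsubseteq>\<^bsub>L\<^esub> X \<longrightarrow> G \<sqsubseteq>\<^bsub>L\<^esub> G' \<longrightarrow> G' = G)}"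

definition building_set :: "('a, 'b) gorder_scheme \<Rightarrow> 'a set \<Rightarrow> bool" where
  "building_set L \<G> \<longleftrightarrow> \<G> \<subseteq> carrier L - {\<bottom>\<^bsub>L\<^esub>} \<and>
     (\<forall>X\<in>carrier L - {\<bottom>\<^bsub>L\<^esub>}.
        let M = max_below L \<G> X; P = (\<Pi>\<^sub>E G\<in>M. \<lbrace>\<bottom>\<^bsub>L\<^esub>..G\<rbrace>\<^bsub>L\<^esub>) in
        \<exists>\<phi>. bij_betw \<phi> P \<lbrace>\<bottom>\<^bsub>L\<^esub>..X\<rbrace>\<^bsub>L\<^esub> \<and>
            (\<forall>f\<in>P. \<forall>g\<in>P. \<phi> f \<sqsubseteq>\<^bsub>L\<^esub> \<phi> g \<longleftrightarrow> (\<forall>G\<in>M. f G \<sqsubseteq>\<^bsub>L\<^esub> g G)) \<and>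
            (\<forall>G\<in>M. \<phi> (\<lambda>H\<in>M. if H = G then G else \<bottom>\<^bsub>L\<^esub>) = G))"

definition nested_set :: "('a, 'b) gorder_scheme \<Rightarrow> 'a set \<Rightarrow> 'a set \<Rightarrow> bool" where
  "nested_set L \<G> N \<longleftrightarrow> finite N \<and> N \<subseteq> \<G> \<and>
     (\<forall>S\<subseteq>N. card S \<ge> 2 \<longrightarrow>
        (\<forall>x\<in>S. \<forall>y\<in>S. x \<noteq> y \<longrightarrow> \<not> x \<sqsubseteq>\<^bsub>L\<^esub> y) \<longrightarrow> \<Squnion>\<^bsub>L\<^esub>S \<notin> \<G>)"


section \<open>Polynomial algebras over the rationals, quotients and isomorphisms\<close>

text \<open>A monomial is a finitely supported exponent function, and a polynomial is a finitely
  supported function from monomials to coefficients.\<close>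

type_synonym 'v mpoly = "('v \<Rightarrow>\<^sub>0 nat) \<Rightarrow>\<^sub>0 rat"

definition pvar :: "'v \<Rightarrow> 'v mpoly" where
  "pvar v = Poly_Mapping.single (Poly_Mapping.single v 1) 1"

definition pconst :: "rat \<Rightarrow> 'v mpoly" where
  "pconst c = Poly_Mapping.single 0 c"

definition mpoly_algebra :: "'v set \<Rightarrow> (rat, 'v mpoly) module" where
  "mpoly_algebra V =
     \<lparr>carrier = {p. \<forall>m\<in>Poly_Mapping.keys p. Poly_Mapping.keys m \<subseteq> V},
      mult = (*), one = 1, zero = 0, add = (+), smult = (\<lambda>c p. pconst c * p)\<rparr>"

definition quot_algebra :: "('k, 'p) module \<Rightarrow> 'p set \<Rightarrow> ('k, 'p set) module" where
  "quot_algebra A J =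
     ring.extend (A Quot J) (module.fields (\<lambda>c X. \<Union>x\<in>X. J +>\<^bsub>A\<^esub> (c \<odot>\<^bsub>A\<^esub> x)))"

definition algebra_isomorphic :: "(rat, 'p) module \<Rightarrow> (rat, 'q) module \<Rightarrow> bool" where
  "algebra_isomorphic A B \<longleftrightarrow>
     (\<exists>h\<in>ring_iso A B. \<forall>c. \<forall>x\<in>carrier A. h (c \<odot>\<^bsub>A\<^esub> x) = c \<odot>\<^bsub>B\<^esub> h x)"

lemma mpoly_add_closed:
  "p \<in> carrier (mpoly_algebra V) \<Longrightarrow> q \<in> carrier (mpoly_algebra V) \<Longrightarrow>
   p + q \<in> carrier (mpoly_algebra V)"
  using Poly_Mapping.keys_add[of p q] by (fastforce simp: mpoly_algebra_def)

lemma mpoly_mult_closed: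
  "p \<in> carrier (mpoly_algebra V) \<Longrightarrow> q \<in> carrier (mpoly_algebra V) \<Longrightarrow>
   p * q \<in> carrier (mpoly_algebra V)"
proof -
  assume p: "p \<in> carrier (mpoly_algebra V)" and q: "q \<in> carrier (mpoly_algebra V)"
  have "Poly_Mapping.keys m \<subseteq> V" if m: "m \<in> Poly_Mapping.keys (p * q)" for m
  proof -
    from m obtain a b where ab: "m = a + b" "a \<in> Poly_Mapping.keys p" "b \<in> Poly_Mapping.keys q"
      using Poly_Mapping.keys_mult[of p q] by blast
    then have "Poly_Mapping.keys m \<subseteq> Poly_Mapping.keys a \<union> Poly_Mapping.keys b"
      using Poly_Mapping.keys_add[of a b] by simp
    also have "\<dots> \<subseteq> V" using ab p q by (auto simp: mpoly_algebra_def)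
    finally show ?thesis using ab by simp
  qed
  then show ?thesis by (auto simp: mpoly_algebra_def)
qed

lemma pvar_in_carrier: "v \<in> V \<Longrightarrow> pvar v \<in> carrier (mpoly_algebra V)"
  by (auto simp: pvar_def mpoly_algebra_def)

lemma pconst_in_carrier: "pconst c \<in> carrier (mpoly_algebra V)"
  by (auto simp: pconst_def mpoly_algebra_def)

lemma mpoly_uminus_closed:
  "p \<in> carrier (mpoly_algebra V) \<Longrightarrow> - p \<in> carrier (mpoly_algebra V)"
  by (auto simp: mpoly_algebra_def in_keys_iff)

lemma cring_mpoly_algebra: "cring (mpoly_algebra V)"
proof (rule cringI)
  show "abelian_group (mpoly_algebra V)"
  proof (rule abelian_groupI)
    fix x assume x: "x \<in> carrier (mpoly_algebra V)"
    show "\<exists>y\<in>carrier (mpoly_algebra V). y \<oplus>\<^bsub>mpoly_algebra V\<^esub> x = \<zero>\<^bsub>mpoly_algebra V\<^esub>"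
      by (rule bexI[OF _ mpoly_uminus_closed[OF x]]) (simp add: mpoly_algebra_def)
  next
    fix x y assume "x \<in> carrier (mpoly_algebra V)" "y \<in> carrier (mpoly_algebra V)"
    then show "x \<oplus>\<^bsub>mpoly_algebra V\<^esub> y \<in> carrier (mpoly_algebra V)"
      using mpoly_add_closed by (simp add: mpoly_algebra_def)
  qed (auto simp: mpoly_algebra_def algebra_simps)
  show "Group.comm_monoid (mpoly_algebra V)"
  proof (rule comm_monoidI)
    fix x y assume "x \<in> carrier (mpoly_algebra V)" "y \<in> carrier (mpoly_algebra V)"
    then show "x \<otimes>\<^bsub>mpoly_algebra V\<^esub> y \<in> carrier (mpoly_algebra V)"
      using mpoly_mult_closed by (simp add: mpoly_algebra_def)
  qed (auto simp: mpoly_algebra_def algebra_simps)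
qed (auto simp: mpoly_algebra_def algebra_simps)

lemma quot_algebra_simps:
  "carrier (quot_algebra A J) = carrier (A Quot J)"
  "mult (quot_algebra A J) = mult (A Quot J)"
  "one (quot_algebra A J) = one (A Quot J)"
  "zero (quot_algebra A J) = zero (A Quot J)"
  "add (quot_algebra A J) = add (A Quot J)"
  "c \<odot>\<^bsub>quot_algebra A J\<^esub> X = (\<Union>x\<in>X. J +>\<^bsub>A\<^esub> (c \<odot>\<^bsub>A\<^esub> x))"
  by (simp_all add: quot_algebra_def ring.defs module.defs)

lemma smult_quot_mpoly_algebra:
  assumes J: "ideal J (mpoly_algebra V)" and p: "p \<in> carrier (mpoly_algebra V)"
  shows "c \<odot>\<^bsub>quot_algebra (mpoly_algebra V) J\<^esub> (J +>\<^bsub>mpoly_algebra V\<^esub> p) =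
         J +>\<^bsub>mpoly_algebra V\<^esub> (c \<odot>\<^bsub>mpoly_algebra V\<^esub> p)"
proof -
  let ?A = "mpoly_algebra V"
  interpret ideal J ?A by (rule J)
  have sm: "c \<odot>\<^bsub>?A\<^esub> x = pconst c \<otimes>\<^bsub>?A\<^esub> x" for x by (simp add: mpoly_algebra_def)
  have k: "pconst c \<in> carrier ?A" by (rule pconst_in_carrier)
  have "J +>\<^bsub>?A\<^esub> (pconst c \<otimes>\<^bsub>?A\<^esub> x) = J +>\<^bsub>?A\<^esub> (pconst c \<otimes>\<^bsub>?A\<^esub> p)"
    if x: "x \<in> J +>\<^bsub>?A\<^esub> p" for x
  proof -
    from x obtain j where j: "j \<in> J" "x = j \<oplus>\<^bsub>?A\<^esub> p" by (auto simp: a_r_coset_def')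
    have "pconst c \<otimes>\<^bsub>?A\<^esub> x = (pconst c \<otimes>\<^bsub>?A\<^esub> j) \<oplus>\<^bsub>?A\<^esub> (pconst c \<otimes>\<^bsub>?A\<^esub> p)"
      using j k p a_subset by (auto simp: r_distr)
    moreover have "pconst c \<otimes>\<^bsub>?A\<^esub> j \<in> J" using I_l_closed j k by auto
    ultimately have "pconst c \<otimes>\<^bsub>?A\<^esub> x \<in> J +>\<^bsub>?A\<^esub> (pconst c \<otimes>\<^bsub>?A\<^esub> p)"
      by (auto simp: a_r_coset_def')
    then show ?thesis
      using a_repr_independence[OF _ _ a_subgroup] k p by auto
  qed
  moreover have "p \<in> J +>\<^bsub>?A\<^esub> p" by (rule a_rcos_self) (use p in auto)
  ultimately show ?thesis
    unfolding quot_algebra_simps sm by blast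
qed


section \<open>The Feichtner--Yuzvinsky Chow ring\<close>

text \<open>This is meant for finite lattices: the sums below range over finite sets only there.\<close>

definition fy_monomial_relations :: "('a, 'b) gorder_scheme \<Rightarrow> 'a set \<Rightarrow> 'a mpoly set" where
  "fy_monomial_relations L \<G> =
     {\<Prod>G\<in>S. pvar G | S. finite S \<and> S \<subseteq> \<G> \<and> \<not> nested_set L \<G> S}"

definition fy_linear_relations :: "('a, 'b) gorder_scheme \<Rightarrow> 'a set \<Rightarrow> 'a mpoly set" where
  "fy_linear_relations L \<G> = {\<Sum>G\<in>{G \<in> \<G>. H \<sqsubseteq>\<^bsub>L\<^esub> G}. pvar G | H. H \<in> atoms L}"

definition fy_chow_ring ::
    "('a, 'b) gorder_scheme \<Rightarrow> 'a set \<Rightarrow> (rat, 'a mpoly set) module" where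
  "fy_chow_ring L \<G> =
     (let R = mpoly_algebra \<G> in
      quot_algebra R
        (Idl\<^bsub>R\<^esub> (fy_monomial_relations L \<G>) <+>\<^bsub>R\<^esub> Idl\<^bsub>R\<^esub> (fy_linear_relations L \<G>)))"


section \<open>The lattice of independent sets and flats\<close>

text \<open>The disjoint union of the independent sets and the flats; \<open>Flat F\<close> is $F_*$.\<close>

datatype 'a aug_elem = Indep "'a set" | Flat "'a set"

inductive aug_le :: "'a set \<Rightarrow> 'a set set \<Rightarrow> 'a aug_elem \<Rightarrow> 'a aug_elem \<Rightarrow> bool"
  for E :: "'a set" and Ind :: "'a set set" where
  indep_incl: "I \<in> Ind \<Longrightarrow> J \<in> Ind \<Longrightarrow> I \<subseteq> J \<Longrightarrow> aug_le E Ind (Indep I) (Indep J)"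
| flat_incl: "F \<in> flats E Ind \<Longrightarrow> G \<in> flats E Ind \<Longrightarrow> F \<subseteq> G \<Longrightarrow>
    aug_le E Ind (Flat F) (Flat G)"
| indep_cl: "I \<in> Ind \<Longrightarrow> aug_le E Ind (Indep I) (Flat (mcl E Ind I))"
| trans: "aug_le E Ind x y \<Longrightarrow> aug_le E Ind y z \<Longrightarrow> aug_le E Ind x z"

definition aug_lattice :: "'a set \<Rightarrow> 'a set set \<Rightarrow> 'a aug_elem gorder" where
  "aug_lattice E Ind =
     \<lparr>carrier = Indep ` Ind \<union> Flat ` flats E Ind, eq = (=), le = aug_le E Ind\<rparr>"

definition aug_building_set :: "'a set \<Rightarrow> 'a set set \<Rightarrow> 'a aug_elem set" where
  "aug_building_set E Ind = (\<lambda>i. Indep {i}) ` E \<union> Flat ` flats E Ind"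

context matroid
begin

abbreviation "AL \<equiv> aug_lattice E Ind"

lemma aug_le_dest:
  assumes "aug_le E Ind x y"
  shows "(\<exists>I\<in>Ind. \<exists>J\<in>Ind. x = Indep I \<and> y = Indep J \<and> I \<subseteq> J) \<or>
    (\<exists>I\<in>Ind. \<exists>F\<in>flats E Ind. x = Indep I \<and> y = Flat F \<and> I \<subseteq> F) \<or>
    (\<exists>F\<in>flats E Ind. \<exists>G\<in>flats E Ind. x = Flat F \<and> y = Flat G \<and> F \<subseteq> G)"
  using assms
proof (induction rule: aug_le.induct)
  case (indep_incl I J)
  then show ?case by blast
next
  case (flat_incl F G)
  then show ?case by blast
next
  case (indep_cl I)
  then have "I \<subseteq> E" by (rule indep_subset_ground)
  then have "mcl E Ind I \<in> flats E Ind" "I \<subseteq> mcl E Ind I"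
    by (rule mcl_in_flats, rule subset_mcl)
  with indep_cl show ?case by blast
next
  case (trans x y z)
  from trans.IH show ?case by (cases x; cases y; cases z) auto
qed

lemma aug_le_simps:
  "aug_le E Ind (Indep I) (Indep J) \<longleftrightarrow> I \<in> Ind \<and> J \<in> Ind \<and> I \<subseteq> J"
  "aug_le E Ind (Flat F) (Flat G) \<longleftrightarrow> F \<in> flats E Ind \<and> G \<in> flats E Ind \<and> F \<subseteq> G"
  "aug_le E Ind (Indep I) (Flat G) \<longleftrightarrow> I \<in> Ind \<and> G \<in> flats E Ind \<and> I \<subseteq> G"
  "\<not> aug_le E Ind (Flat F) (Indep J)"
proof -
  show "aug_le E Ind (Indep I) (Flat G) \<longleftrightarrow> I \<in> Ind \<and> G \<in> flats E Ind \<and> I \<subseteq> G"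
  proof
    assume *: "I \<in> Ind \<and> G \<in> flats E Ind \<and> I \<subseteq> G"
    then have "aug_le E Ind (Flat (mcl E Ind I)) (Flat G)"
      using mcl_least mcl_in_flats indep_subset_ground by (intro aug_le.flat_incl) auto
    with * show "aug_le E Ind (Indep I) (Flat G)"
      using aug_le.indep_cl aug_le.trans by metis
  qed (use aug_le_dest[of "Indep I" "Flat G"] in auto)
  show "aug_le E Ind (Indep I) (Indep J) \<longleftrightarrow> I \<in> Ind \<and> J \<in> Ind \<and> I \<subseteq> J"
    using aug_le_dest[of "Indep I" "Indep J"] aug_le.indep_incl by auto
  show "aug_le E Ind (Flat F) (Flat G) \<longleftrightarrow> F \<in> flats E Ind \<and> G \<in> flats E Ind \<and> F \<subseteq> G"
    using aug_le_dest[of "Flat F" "Flat G"] aug_le.flat_incl by auto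
  show "\<not> aug_le E Ind (Flat F) (Indep J)"
    using aug_le_dest[of "Flat F" "Indep J"] by auto
qed

lemma AL_simps [simp]:
  "carrier AL = Indep ` Ind \<union> Flat ` flats E Ind"
  "x .=\<^bsub>AL\<^esub> y \<longleftrightarrow> x = y"
  "x \<sqsubseteq>\<^bsub>AL\<^esub> y \<longleftrightarrow> aug_le E Ind x y"
  by (simp_all add: aug_lattice_def)

lemma finite_AL: "finite (carrier AL)"
  using finite_indep finite_flats by simp

lemma partial_order_AL: "partial_order AL"
proof
  fix x y assume "x \<sqsubseteq>\<^bsub>AL\<^esub> y" "y \<sqsubseteq>\<^bsub>AL\<^esub> x"
  then show "x .=\<^bsub>AL\<^esub> y" by (cases x; cases y) (auto simp: aug_le_simps)
next
  fix x y z assume "x \<sqsubseteq>\<^bsub>AL\<^esub> y" "y \<sqsubseteq>\<^bsub>AL\<^esub> z"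
  then show "x \<sqsubseteq>\<^bsub>AL\<^esub> z" using aug_le.trans by simp
qed (auto simp: aug_le_simps aug_lattice_def)

lemma greatest_AL:
  assumes A: "A \<subseteq> carrier AL"
  shows "\<exists>i. greatest AL i (Lower AL A)"
proof (cases "\<exists>I. Indep I \<in> A")
  case True
  then obtain I where I: "Indep I \<in> A" by auto
  define B where "B = {x. \<forall>y\<in>A. case y of Indep J \<Rightarrow> x \<in> J | Flat F \<Rightarrow> x \<in> F}"
  have "B \<subseteq> I" using I by (force simp: B_def)
  moreover have "I \<in> Ind" using I A by auto
  ultimately have B: "B \<in> Ind" using indep_subset by blast
  have le: "aug_le E Ind (Indep B) y" if "y \<in> A" for y
    using that A B by (cases y) (force simp: B_def aug_le_simps)+
  have "aug_le E Ind z (Indep B)" if z: "\<forall>y\<in>A. aug_le E Ind z y" for z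
  proof -
    have "aug_le E Ind z (Indep I)" using z I by auto
    then obtain J where J: "z = Indep J" "J \<in> Ind" by (cases z) (auto simp: aug_le_simps)
    have "x \<in> B" if "x \<in> J" for x
      unfolding B_def using z J that by (force simp: aug_le_simps split: aug_elem.splits)
    with J B show ?thesis by (auto simp: aug_le_simps)
  qed
  then have "greatest AL (Indep B) (Lower AL A)"
    using A B le by (auto simp: greatest_def Lower_def subset_iff)
  then show ?thesis by blast
next
  case False
  define \<F> where "\<F> = {F. Flat F \<in> A}"
  have AF: "A = Flat ` \<F>"
  proof
    show "A \<subseteq> Flat ` \<F>"
    proof
      fix a assume "a \<in> A"
      with False show "a \<in> Flat ` \<F>" by (cases a) (auto simp: \<F>_def)
    qed
  qed (auto simp: \<F>_def)
  have F: "\<F> \<subseteq> flats E Ind" using A unfolding AF by auto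
  define B where "B = E \<inter> \<Inter>\<F>"
  have B: "B \<in> flats E Ind" unfolding B_def using F by (rule Inter_in_flats)
  have "aug_le E Ind (Flat B) y" if "y \<in> A" for y
    using that B F by (auto simp: AF B_def aug_le_simps)
  moreover have "aug_le E Ind z (Flat B)"
    if "\<forall>y\<in>A. aug_le E Ind z y" "z \<in> carrier AL" for z
    using that B F indep_subset_ground
    by (cases z) (force simp: AF B_def aug_le_simps flats_def)+
  ultimately have "greatest AL (Flat B) (Lower AL A)"
    using A B by (auto simp: greatest_def Lower_def subset_iff)
  then show ?thesis by blast
qed

lemma complete_lattice_AL: "complete_lattice AL"
proof -
  interpret partial_order AL by (rule partial_order_AL)
  show ?thesis
  proof (rule complete_lattice_criterion1)
    have "greatest AL (Flat E) (carrier AL)"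
      using ground_in_flats indep_subset_ground
      by (auto simp: greatest_def aug_le_simps flats_def)
    then show "\<exists>g. greatest AL g (carrier AL)" by blast
  qed (rule greatest_AL)
qed

lemma least_AL: "least AL (Indep {}) (carrier AL)"
  using indep_empty by (auto simp: least_def aug_le_simps)

lemma bottom_AL: "\<bottom>\<^bsub>AL\<^esub> = Indep {}"
proof -
  interpret partial_order AL by (rule partial_order_AL)
  have "least AL \<bottom>\<^bsub>AL\<^esub> (carrier AL)"
    unfolding bottom_def using least_AL by (rule someI)
  then show ?thesis using least_AL least_unique by blast
qed

lemma atoms_AL:
  assumes "loopless E Ind"
  shows "atoms AL = (\<lambda>i. Indep {i}) ` E \<union> {Flat {}}"
proof -
  note [simp] = bottom_AL aug_le_simps
  have 1: "Indep {i} \<in> atoms AL" if "i \<in> E" for i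
    using that assms by (auto simp: atoms_def loopless_def)
  have 2: "Flat {} \<in> atoms AL"
    using empty_in_flats[OF assms] by (auto simp: atoms_def)
  have 3: "x \<in> (\<lambda>i. Indep {i}) ` E \<union> {Flat {}}" if x: "x \<in> atoms AL" for x
  proof (cases x)
    case (Indep I)
    with x have I: "I \<in> Ind" "I \<noteq> {}" by (auto simp: atoms_def)
    then obtain i where i: "i \<in> I" by auto
    then have "{i} \<in> Ind" "i \<in> E" using I indep_subset indep_subset_ground by auto
    moreover have "Indep {i} = x"
    proof -
      have "Indep {i} \<in> carrier AL" "Indep {i} \<sqsubseteq>\<^bsub>AL\<^esub> x"
        using \<open>{i} \<in> Ind\<close> i I Indep by auto
      then have "Indep {i} = \<bottom>\<^bsub>AL\<^esub> \<or> Indep {i} = x" using x unfolding atoms_def by blast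
      then show ?thesis by simp
    qed
    ultimately show ?thesis by auto
  next
    case (Flat F)
    with x have "F \<in> flats E Ind" by (auto simp: atoms_def)
    then have "Flat {} \<in> carrier AL" "Flat {} \<sqsubseteq>\<^bsub>AL\<^esub> x"
      using Flat empty_in_flats[OF assms] by auto
    then have "Flat {} = \<bottom>\<^bsub>AL\<^esub> \<or> Flat {} = x" using x unfolding atoms_def by blast
    then have "Flat {} = x" by simp
    then show ?thesis by auto
  qed
  show ?thesis using 1 2 3 by blast
qed

lemma atomic_lattice_AL:
  assumes "loopless E Ind"
  shows "atomic_lattice AL"
proof -
  interpret complete_lattice AL by (rule complete_lattice_AL)
  have "least AL x (Upper AL {H \<in> atoms AL. H \<sqsubseteq>\<^bsub>AL\<^esub> x})" if x: "x \<in> carrier AL" for x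
  proof -
    have le: "aug_le E Ind x y"
      if y: "y \<in> carrier AL" "\<forall>H\<in>atoms AL. aug_le E Ind H x \<longrightarrow> aug_le E Ind H y" for y
    proof (cases x)
      case (Indep I)
      then have I: "I \<in> Ind" using x by auto
      have le_y: "aug_le E Ind (Indep {i}) y" if "i \<in> I" for i
      proof -
        have "i \<in> E" using that indep_subset_ground[OF I] by blast
        then have "Indep {i} \<in> atoms AL" "{i} \<in> Ind"
          using assms unfolding atoms_AL[OF assms] loopless_def by blast+
        moreover from this have "aug_le E Ind (Indep {i}) x"
          using that I Indep by (simp add: aug_le_simps)
        ultimately show ?thesis using y(2) by blast
      qed
      show ?thesis
      proof (cases y)
        case (Indep J)
        then have "J \<in> Ind" using y(1) by auto
        then show ?thesis
          using le_y I unfolding \<open>x = Indep I\<close> Indep aug_le_simps by blast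
      next
        case (Flat G)
        then have "G \<in> flats E Ind" using y(1) by auto
        then show ?thesis
          using le_y I unfolding \<open>x = Indep I\<close> Flat aug_le_simps by blast
      qed
    next
      case (Flat F)
      then have F: "F \<in> flats E Ind" "F \<subseteq> E" using x by (auto simp: flats_def)
      have "Flat {} \<in> atoms AL" unfolding atoms_AL[OF assms] by blast
      moreover have "aug_le E Ind (Flat {}) x"
        using F Flat empty_in_flats[OF assms] by (simp add: aug_le_simps)
      ultimately have "aug_le E Ind (Flat {}) y" using y(2) by blast
      then obtain G where G: "y = Flat G" "G \<in> flats E Ind"
        by (cases y) (auto simp: aug_le_simps)
      have "i \<in> G" if "i \<in> F" for i
      proof -
        have "i \<in> E" using that F by blast
        then have "Indep {i} \<in> atoms AL" "{i} \<in> Ind"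
          using assms unfolding atoms_AL[OF assms] loopless_def by blast+
        moreover from this have "aug_le E Ind (Indep {i}) x"
          using that F Flat by (simp add: aug_le_simps)
        ultimately have "aug_le E Ind (Indep {i}) y" using y(2) by blast
        then show ?thesis unfolding G aug_le_simps by blast
      qed
      then show ?thesis unfolding Flat G aug_le_simps using F G by blast
    qed
    have sub: "{H \<in> atoms AL. H \<sqsubseteq>\<^bsub>AL\<^esub> x} \<subseteq> carrier AL"
      unfolding atoms_def by blast
    show ?thesis
    proof (rule least_UpperI[OF _ _ sub x])
      fix y assume y: "y \<in> Upper AL {H \<in> atoms AL. H \<sqsubseteq>\<^bsub>AL\<^esub> x}"
      have "y \<in> carrier AL" using Upper_closed y by (rule subsetD)
      moreover have "aug_le E Ind H y" if "H \<in> atoms AL" "aug_le E Ind H x" for H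
        using Upper_memD[OF y _ sub, of H] that by (simp del: AL_simps(1))
      ultimately show "x \<sqsubseteq>\<^bsub>AL\<^esub> y" using le by (simp del: AL_simps(1))
    qed (simp del: AL_simps(1))
  qed
  moreover have "lattice AL" by unfold_locales
  ultimately show ?thesis
    unfolding atomic_lattice_def using least_AL by blast
qed

lemma building_set_AL:
  assumes "loopless E Ind"
  shows "building_set AL (aug_building_set E Ind)"
  unfolding building_set_def
proof (intro conjI ballI)
  show "aug_building_set E Ind \<subseteq> carrier AL - {\<bottom>\<^bsub>AL\<^esub>}"
    using assms by (auto simp: aug_building_set_def bottom_AL loopless_def)
next
  note [simp] = bottom_AL aug_le_simps
  let ?G = "aug_building_set E Ind"
  fix X assume X: "X \<in> carrier AL - {\<bottom>\<^bsub>AL\<^esub>}"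
  let ?M = "max_below AL ?G X"
  let ?P = "\<Pi>\<^sub>E G\<in>?M. \<lbrace>\<bottom>\<^bsub>AL\<^esub>..G\<rbrace>\<^bsub>AL\<^esub>"
  let ?goal = "\<lambda>\<phi>. bij_betw \<phi> ?P \<lbrace>\<bottom>\<^bsub>AL\<^esub>..X\<rbrace>\<^bsub>AL\<^esub> \<and>
     (\<forall>f\<in>?P. \<forall>g\<in>?P. \<phi> f \<sqsubseteq>\<^bsub>AL\<^esub> \<phi> g \<longleftrightarrow> (\<forall>G\<in>?M. f G \<sqsubseteq>\<^bsub>AL\<^esub> g G)) \<and>
     (\<forall>G\<in>?M. \<phi> (\<lambda>H\<in>?M. if H = G then G else \<bottom>\<^bsub>AL\<^esub>) = G)"
  have "\<exists>\<phi>. ?goal \<phi>"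
  proof (cases X)
    case (Flat F)
    then have F: "F \<in> flats E Ind" using X by auto
    have FG: "Flat F \<in> ?G" using F by (simp add: aug_building_set_def)
    have FX: "aug_le E Ind (Flat F) X" using F Flat by simp
    have M: "?M = {Flat F}"
    proof
      show "?M \<subseteq> {Flat F}"
      proof
        fix G assume "G \<in> ?M"
        then have "aug_le E Ind G (Flat F)" and
          "\<forall>G'\<in>?G. aug_le E Ind G' X \<longrightarrow> aug_le E Ind G G' \<longrightarrow> G' = G"
          unfolding max_below_def AL_simps(3) Flat by blast+
        then show "G \<in> {Flat F}" using FG FX by blast
      qed
      show "{Flat F} \<subseteq> ?M"
      proof -
        have "G' = Flat F" if "aug_le E Ind G' X" "aug_le E Ind (Flat F) G'" for G'
          using that unfolding Flat by (cases G') auto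
        then show ?thesis using FG FX unfolding max_below_def AL_simps(3) by blast
      qed
    qed
    have inj: "inj_on (\<lambda>f. f (Flat F)) ?P"
    proof (rule inj_onI)
      fix f g assume "f \<in> ?P" "g \<in> ?P" "f (Flat F) = g (Flat F)"
      then show "f = g" unfolding M by (intro PiE_ext[of f "{Flat F}" _ g]) simp_all
    qed
    have img: "(\<lambda>f. f (Flat F)) ` ?P = \<lbrace>\<bottom>\<^bsub>AL\<^esub>..X\<rbrace>\<^bsub>AL\<^esub>"
    proof
      show "(\<lambda>f. f (Flat F)) ` ?P \<subseteq> \<lbrace>\<bottom>\<^bsub>AL\<^esub>..X\<rbrace>\<^bsub>AL\<^esub>"
        unfolding M unfolding Flat by (intro image_subsetI) (erule PiE_mem, simp)
      show "\<lbrace>\<bottom>\<^bsub>AL\<^esub>..X\<rbrace>\<^bsub>AL\<^esub> \<subseteq> (\<lambda>f. f (Flat F)) ` ?P"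
      proof
        fix Y assume "Y \<in> \<lbrace>\<bottom>\<^bsub>AL\<^esub>..X\<rbrace>\<^bsub>AL\<^esub>"
        then have "(\<lambda>x\<in>{Flat F}. Y) \<in> ?P"
          unfolding M unfolding Flat by (intro restrict_PiE_iff[THEN iffD2]) simp
        then show "Y \<in> (\<lambda>f. f (Flat F)) ` ?P" by (rule rev_image_eqI) simp
      qed
    qed
    from inj img show ?thesis
      unfolding bij_betw_def M by (intro exI[of _ "\<lambda>f. f (Flat F)"] conjI) simp_all
  next
    case (Indep I)
    then have I: "I \<in> Ind" using X by auto
    have sing: "{i} \<in> Ind" "i \<in> E" if "i \<in> I" for i
      using that I indep_subset indep_subset_ground by auto
    have M: "?M = (\<lambda>i. Indep {i}) ` I"
    proof
      show "?M \<subseteq> (\<lambda>i. Indep {i}) ` I"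
      proof
        fix G assume "G \<in> ?M"
        then have "G \<in> ?G" "aug_le E Ind G (Indep I)"
          unfolding max_below_def AL_simps(3) Indep by blast+
        then show "G \<in> (\<lambda>i. Indep {i}) ` I"
          unfolding aug_building_set_def by auto
      qed
      show "(\<lambda>i. Indep {i}) ` I \<subseteq> ?M"
      proof
        fix G assume "G \<in> (\<lambda>i. Indep {i}) ` I"
        then obtain i where i: "i \<in> I" "G = Indep {i}" by blast
        have "G' = G" if "G' \<in> ?G" "aug_le E Ind G' X" "aug_le E Ind G G'" for G'
          using that i unfolding Indep aug_building_set_def by (cases G') auto
        moreover have "G \<in> ?G" using i sing by (simp add: aug_building_set_def)
        moreover have "aug_le E Ind G X" using i sing I Indep by simp
        ultimately show "G \<in> ?M" unfolding max_below_def AL_simps(3) by blast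
      qed
    qed
    have interval: "\<lbrace>\<bottom>\<^bsub>AL\<^esub>..Indep J\<rbrace>\<^bsub>AL\<^esub> = Indep ` Pow J" if J: "J \<in> Ind" for J
      using J indep_subset indep_empty by (auto simp: at_least_at_most_def)
    define \<phi> where "\<phi> f = Indep {i \<in> I. f (Indep {i}) = Indep {i}}" for f
    have val: "f (Indep {i}) = Indep {} \<or> f (Indep {i}) = Indep {i}"
      if "f \<in> ?P" "i \<in> I" for f i
    proof -
      have "f (Indep {i}) \<in> \<lbrace>\<bottom>\<^bsub>AL\<^esub>..Indep {i}\<rbrace>\<^bsub>AL\<^esub>" using that M by (auto simp: PiE_iff)
      then show ?thesis using interval[OF sing(1)[OF that(2)]] by auto
    qed
    have sub: "{i \<in> I. f (Indep {i}) = Indep {i}} \<in> Ind" for f :: "'a aug_elem \<Rightarrow> 'a aug_elem"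
      by (rule indep_subset[OF I]) auto
    have order: "\<phi> f \<sqsubseteq>\<^bsub>AL\<^esub> \<phi> g \<longleftrightarrow> (\<forall>G\<in>?M. f G \<sqsubseteq>\<^bsub>AL\<^esub> g G)" if fg: "f \<in> ?P" "g \<in> ?P" for f g
    proof -
      have "f (Indep {i}) \<sqsubseteq>\<^bsub>AL\<^esub> g (Indep {i}) \<longleftrightarrow>
          (f (Indep {i}) = Indep {i} \<longrightarrow> g (Indep {i}) = Indep {i})" if "i \<in> I" for i
        using val[OF fg(1) that] val[OF fg(2) that] sing[OF that] indep_empty
        by auto
      then show ?thesis using sub by (auto simp: \<phi>_def M)
    qed
    have inj: "inj_on \<phi> ?P"
    proof (rule inj_onI)
      fix f g assume fg: "f \<in> ?P" "g \<in> ?P" "\<phi> f = \<phi> g"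
      show "f = g"
      proof (rule PiE_ext[OF fg(1,2)])
        fix G assume "G \<in> ?M"
        then obtain i where i: "i \<in> I" "G = Indep {i}" using M by auto
        have "f (Indep {i}) = Indep {i} \<longleftrightarrow> g (Indep {i}) = Indep {i}"
          using fg(3) i by (auto simp: \<phi>_def)
        then show "f G = g G" using val[OF fg(1) i(1)] val[OF fg(2) i(1)] i by auto
      qed
    qed
    have img: "\<phi> ` ?P = \<lbrace>\<bottom>\<^bsub>AL\<^esub>..X\<rbrace>\<^bsub>AL\<^esub>"
    proof
      show "\<phi> ` ?P \<subseteq> \<lbrace>\<bottom>\<^bsub>AL\<^esub>..X\<rbrace>\<^bsub>AL\<^esub>"
        unfolding Indep interval[OF I] by (auto simp: \<phi>_def)
      show "\<lbrace>\<bottom>\<^bsub>AL\<^esub>..X\<rbrace>\<^bsub>AL\<^esub> \<subseteq> \<phi> ` ?P"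
      proof
        fix Y assume "Y \<in> \<lbrace>\<bottom>\<^bsub>AL\<^esub>..X\<rbrace>\<^bsub>AL\<^esub>"
        then obtain J where J: "Y = Indep J" "J \<subseteq> I" unfolding Indep interval[OF I] by auto
        define f where "f = (\<lambda>G\<in>?M. if G \<in> (\<lambda>i. Indep {i}) ` J then G else Indep {})"
        have "f \<in> ?P"
          unfolding f_def using sing interval[OF sing(1)] by (auto simp: M)
        moreover have "\<phi> f = Y" using J by (auto simp: \<phi>_def f_def M)
        ultimately show "Y \<in> \<phi> ` ?P" by blast
      qed
    qed
    have "\<phi> (\<lambda>H\<in>?M. if H = G then G else \<bottom>\<^bsub>AL\<^esub>) = G" if "G \<in> ?M" for G
      using that by (auto simp: \<phi>_def M)
    with order inj img have "?goal \<phi>" unfolding bij_betw_def by blast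
    then show ?thesis by blast
  qed
  then show "let M = ?M; P = (\<Pi>\<^sub>E G\<in>M. \<lbrace>\<bottom>\<^bsub>AL\<^esub>..G\<rbrace>\<^bsub>AL\<^esub>) in
     \<exists>\<phi>. bij_betw \<phi> P \<lbrace>\<bottom>\<^bsub>AL\<^esub>..X\<rbrace>\<^bsub>AL\<^esub> \<and>
       (\<forall>f\<in>P. \<forall>g\<in>P. \<phi> f \<sqsubseteq>\<^bsub>AL\<^esub> \<phi> g \<longleftrightarrow> (\<forall>G\<in>M. f G \<sqsubseteq>\<^bsub>AL\<^esub> g G)) \<and>
       (\<forall>G\<in>M. \<phi> (\<lambda>H\<in>M. if H = G then G else \<bottom>\<^bsub>AL\<^esub>) = G)"
    unfolding Let_def .
qed

end


section \<open>The augmented Chow ring\<close>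

datatype 'a aug_var = XVar "'a set" | YVar 'a

definition aug_chow_ring :: "'a set \<Rightarrow> 'a set set \<Rightarrow> (rat, 'a aug_var mpoly set) module" where
  "aug_chow_ring E Ind =
     (let P = flats E Ind - {E};
          R = mpoly_algebra (XVar ` P \<union> YVar ` E);
          I1 = Idl\<^bsub>R\<^esub> {pvar (XVar F) * pvar (XVar G) | F G.
                   F \<in> P \<and> G \<in> P \<and> \<not> F \<subseteq> G \<and> \<not> G \<subseteq> F};
          I2 = Idl\<^bsub>R\<^esub> {pvar (YVar i) * pvar (XVar F) | i F. i \<in> E \<and> F \<in> P \<and> i \<notin> F};
          I3 = Idl\<^bsub>R\<^esub> {pvar (YVar i) - (\<Sum>F\<in>{F \<in> P. i \<notin> F}. pvar (XVar F)) | i. i \<in> E}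
      in quot_algebra R (I1 <+>\<^bsub>R\<^esub> I2 <+>\<^bsub>R\<^esub> I3))"

end

theory Submission
  imports Defs
begin

text \<open>The linear relation of the atom \<open>\<emptyset>\<^sub>*\<close> eliminates \<open>x\<close> at the top flat, and subtracting it
  from the relation of the atom \<open>{i}\<close> leaves \<open>x\<close> at \<open>{i}\<close> equal to the sum of the \<open>x\<close> at the flats
  avoiding \<open>i\<close>, which is the defining relation of \<open>y\<^sub>i\<close>. So the isomorphism matches \<open>{i}\<close> with
  \<open>y\<^sub>i\<close> and \<open>F\<^sub>*\<close> with \<open>x\<^sub>F\<close> for proper \<open>F\<close>. The minimal non-nested sets are the incomparable
  pairs containing a flat, which give the quadratic relations of the augmented Chow ring, and
  the circuits, whose monomials in the \<open>y\<^sub>i\<close> already vanish there.\<close>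

section \<open>Substitution into polynomials\<close>

lemma poly_mapping_sum_singles:
  "p = (\<Sum>m\<in>Poly_Mapping.keys p. Poly_Mapping.single m (Poly_Mapping.lookup p m))"
proof (rule poly_mapping_eqI)
  fix k
  show "Poly_Mapping.lookup p k =
      Poly_Mapping.lookup (\<Sum>m\<in>Poly_Mapping.keys p. Poly_Mapping.single m (Poly_Mapping.lookup p m)) k"
    by (cases "k \<in> Poly_Mapping.keys p")
      (auto simp: lookup_sum lookup_single when_def sum.delta in_keys_iff)
qed

lemma poly_mapping_induct [case_names single add]:
  fixes p :: "'a \<Rightarrow>\<^sub>0 'b::comm_monoid_add"
  assumes "\<And>m c. P (Poly_Mapping.single m c)"
    and "\<And>p q. P p \<Longrightarrow> P q \<Longrightarrow> P (p + q)"
  shows "P p"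
proof -
  have "P (\<Sum>m\<in>M. Poly_Mapping.single m (Poly_Mapping.lookup p m))" if "finite M" for M
    using that
  proof (induction M)
    case empty
    show ?case using assms(1)[of undefined 0] by simp
  qed (simp add: assms)
  then show ?thesis by (subst poly_mapping_sum_singles) simp
qed

definition mono_subst :: "('v \<Rightarrow> 'r) \<Rightarrow> ('v \<Rightarrow>\<^sub>0 nat) \<Rightarrow> 'r::comm_monoid_mult" where
  "mono_subst f m = (\<Prod>v\<in>Poly_Mapping.keys m. f v ^ Poly_Mapping.lookup m v)"

definition msubst :: "('v \<Rightarrow> 'w mpoly) \<Rightarrow> 'v mpoly \<Rightarrow> 'w mpoly" where
  "msubst f p = (\<Sum>m\<in>Poly_Mapping.keys p. pconst (Poly_Mapping.lookup p m) * mono_subst f m)"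

lemma mono_subst_superset:
  assumes "finite A" "Poly_Mapping.keys m \<subseteq> A"
  shows "mono_subst f m = (\<Prod>v\<in>A. f v ^ Poly_Mapping.lookup m v)"
  unfolding mono_subst_def using assms by (intro prod.mono_neutral_left) (auto simp: in_keys_iff)

lemma mono_subst_0 [simp]: "mono_subst f 0 = 1"
  by (simp add: mono_subst_def)

lemma mono_subst_add: "mono_subst f (a + b) = mono_subst f a * mono_subst f b"
proof -
  let ?A = "Poly_Mapping.keys a \<union> Poly_Mapping.keys b"
  have "mono_subst f (a + b) = (\<Prod>v\<in>?A. f v ^ Poly_Mapping.lookup (a + b) v)"
    using Poly_Mapping.keys_add[of a b] by (intro mono_subst_superset) auto
  also have "\<dots> = mono_subst f a * mono_subst f b"
    by (simp add: lookup_add power_add prod.distrib mono_subst_superset[of ?A])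
  finally show ?thesis .
qed

lemma pconst_0 [simp]: "pconst 0 = 0"
  by (simp add: pconst_def)

lemma pconst_1 [simp]: "pconst 1 = 1"
  by (simp add: pconst_def)

lemma pconst_add: "pconst (c + d) = pconst c + pconst d"
  by (simp add: pconst_def single_add)

lemma pconst_mult: "pconst (c * d) = pconst c * pconst d"
  by (simp add: pconst_def mult_single)

lemma msubst_single: "msubst f (Poly_Mapping.single m c) = pconst c * mono_subst f m"
  by (simp add: msubst_def)

lemma msubst_add: "msubst f (p + q) = msubst f p + msubst f q"
  unfolding msubst_def
  by (rule setsum_keys_plus_distrib) (simp_all add: pconst_add distrib_right)

lemma msubst_mult: "msubst f (p * q) = msubst f p * msubst f q"
proof (induction p rule: poly_mapping_induct)
  case (single m c)
  show ?case
  proof (induction q rule: poly_mapping_induct)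
    case (single m' c')
    show ?case by (simp add: mult_single msubst_single mono_subst_add pconst_mult mult_ac)
  qed (simp add: msubst_add distrib_left)
qed (simp add: msubst_add distrib_right)

lemma msubst_pconst [simp]: "msubst f (pconst c) = pconst c"
  by (simp add: pconst_def[of c] msubst_single)

lemma msubst_0 [simp]: "msubst f 0 = 0"
  by (simp add: msubst_def)

lemma msubst_1 [simp]: "msubst f 1 = 1"
  using msubst_pconst[of f 1] by simp

lemma msubst_pvar [simp]: "msubst f (pvar v) = f v"
  by (simp add: pvar_def msubst_single mono_subst_def)

lemma msubst_uminus: "msubst f (- p) = - msubst f p"
  by (metis add.right_inverse msubst_0 msubst_add neg_eq_iff_add_eq_0)

lemma msubst_diff: "msubst f (p - q) = msubst f p - msubst f q"
  using msubst_add[of f p "- q"] by (simp add: msubst_uminus)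

lemma msubst_sum: "msubst f (\<Sum>x\<in>A. g x) = (\<Sum>x\<in>A. msubst f (g x))"
  by (induction A rule: infinite_finite_induct) (simp_all add: msubst_add)

lemma msubst_prod: "msubst f (\<Prod>x\<in>A. g x) = (\<Prod>x\<in>A. msubst f (g x))"
  by (induction A rule: infinite_finite_induct) (simp_all add: msubst_mult)

lemma single_eq_mono_subst: "Poly_Mapping.single m c = pconst c * mono_subst pvar m"
proof -
  have pow: "pvar v ^ k = Poly_Mapping.single (Poly_Mapping.single v k) 1" for v :: 'a and k
    by (induction k) (simp_all add: pvar_def mult_single single_add[symmetric])
  have prod: "(\<Prod>v\<in>A. Poly_Mapping.single (g v) 1) =
      (Poly_Mapping.single (\<Sum>v\<in>A. g v) 1 :: 'a mpoly)" for A :: "'a set" and g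
    by (induction A rule: infinite_finite_induct) (simp_all add: mult_single)
  have "mono_subst pvar m = Poly_Mapping.single m 1"
    unfolding mono_subst_def pow prod poly_mapping_sum_singles[symmetric] ..
  then show ?thesis by (simp add: pconst_def mult_single)
qed

lemma mpoly_algebra_induct [consumes 1, case_names pconst pvar add mult]:
  assumes p: "p \<in> carrier (mpoly_algebra V)"
    and pconst: "\<And>c. P (pconst c)"
    and pvar: "\<And>v. v \<in> V \<Longrightarrow> P (pvar v)"
    and add: "\<And>p q. P p \<Longrightarrow> P q \<Longrightarrow> P (p + q)"
    and mult: "\<And>p q. p \<in> carrier (mpoly_algebra V) \<Longrightarrow> q \<in> carrier (mpoly_algebra V) \<Longrightarrow>
      P p \<Longrightarrow> P q \<Longrightarrow> P (p * q)"
  shows "P p"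
proof -
  let ?C = "\<lambda>p. p \<in> carrier (mpoly_algebra V) \<and> P p"
  have one: "?C 1" using pconst[of 1] pconst_in_carrier[of 1 V] by simp
  have C_mult: "?C (a * b)" if "?C a" "?C b" for a b
    using that mult mpoly_mult_closed by blast
  have pow: "?C (pvar v ^ k)" if "v \<in> V" for v k
  proof (induction k)
    case (Suc k)
    then show ?case using C_mult pvar that pvar_in_carrier by (metis power_Suc)
  qed (use one in simp)
  have prod: "?C (\<Prod>v\<in>A. pvar v ^ k v)" if "finite A" "A \<subseteq> V" for A k
    using that
  proof (induction A)
    case (insert v A)
    then have "?C (pvar v ^ k v)" "?C (\<Prod>v\<in>A. pvar v ^ k v)" using pow by blast+
    from C_mult[OF this] show ?case using insert by simp
  qed (use one in simp)
  have monomial: "P (Poly_Mapping.single m c)" if "Poly_Mapping.keys m \<subseteq> V" for m c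
    unfolding single_eq_mono_subst mono_subst_def
    using prod[OF finite_keys that] pconst pconst_in_carrier by (intro mult) blast+
  have "P (\<Sum>m\<in>M. Poly_Mapping.single m (Poly_Mapping.lookup p m))"
    if "finite M" "M \<subseteq> Poly_Mapping.keys p" for M
    using that
  proof (induction M)
    case empty
    show ?case using pconst[of 0] by simp
  next
    case (insert m M)
    then have "Poly_Mapping.keys m \<subseteq> V" using p by (auto simp: mpoly_algebra_def)
    with insert show ?case by (simp add: add monomial)
  qed
  then show ?thesis by (subst poly_mapping_sum_singles) simp
qed

lemma mpoly_algebra_simps:
  "add (mpoly_algebra V) = (+)" "mult (mpoly_algebra V) = (*)"
  "one (mpoly_algebra V) = 1" "zero (mpoly_algebra V) = 0"
  "smult (mpoly_algebra V) = (\<lambda>c p. pconst c * p)"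
  by (simp_all add: mpoly_algebra_def)

lemma mpoly_sum_closed:
  assumes "\<And>x. x \<in> A \<Longrightarrow> g x \<in> carrier (mpoly_algebra V)"
  shows "(\<Sum>x\<in>A. g x) \<in> carrier (mpoly_algebra V)"
  using assms pconst_in_carrier[of 0 V]
  by (induction A rule: infinite_finite_induct) (simp_all add: mpoly_add_closed)

lemma mpoly_prod_closed:
  assumes "\<And>x. x \<in> A \<Longrightarrow> g x \<in> carrier (mpoly_algebra V)"
  shows "(\<Prod>x\<in>A. g x) \<in> carrier (mpoly_algebra V)"
  using assms pconst_in_carrier[of 1 V]
  by (induction A rule: infinite_finite_induct) (simp_all add: mpoly_mult_closed)

lemma mpoly_diff_closed:
  "p \<in> carrier (mpoly_algebra V) \<Longrightarrow> q \<in> carrier (mpoly_algebra V) \<Longrightarrow>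
   p - q \<in> carrier (mpoly_algebra V)"
  using mpoly_add_closed[OF _ mpoly_uminus_closed, of p V q] by simp

lemma msubst_closed:
  assumes "p \<in> carrier (mpoly_algebra V)" "\<And>v. v \<in> V \<Longrightarrow> f v \<in> carrier (mpoly_algebra W)"
  shows "msubst f p \<in> carrier (mpoly_algebra W)"
  using assms(1)
  by (induction rule: mpoly_algebra_induct)
    (simp_all add: assms(2) pconst_in_carrier msubst_add msubst_mult mpoly_add_closed
      mpoly_mult_closed)

lemma msubst_ring_hom:
  assumes "\<And>v. v \<in> V \<Longrightarrow> f v \<in> carrier (mpoly_algebra W)"
  shows "msubst f \<in> ring_hom (mpoly_algebra V) (mpoly_algebra W)"
  using msubst_closed[OF _ assms]
  by (intro ring_hom_memI) (simp_all add: mpoly_algebra_simps msubst_add msubst_mult)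


section \<open>Ideals and quotients of polynomial algebras\<close>

lemma
  assumes "ideal J (mpoly_algebra V)"
  shows mpoly_ideal_carrier: "J \<subseteq> carrier (mpoly_algebra V)"
    and mpoly_ideal_0: "0 \<in> J"
    and mpoly_ideal_add: "p \<in> J \<Longrightarrow> q \<in> J \<Longrightarrow> p + q \<in> J"
    and mpoly_ideal_mult: "p \<in> J \<Longrightarrow> r \<in> carrier (mpoly_algebra V) \<Longrightarrow> p * r \<in> J"
    and mpoly_ideal_uminus: "p \<in> J \<Longrightarrow> - p \<in> J"
    and mpoly_ideal_diff: "p \<in> J \<Longrightarrow> q \<in> J \<Longrightarrow> p - q \<in> J"
proof -
  interpret ideal J "mpoly_algebra V" by (rule assms)
  show "J \<subseteq> carrier (mpoly_algebra V)" by (rule a_subset)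
  show "0 \<in> J"
    using additive_subgroup.zero_closed[OF additive_subgroup_axioms] by (simp add: mpoly_algebra_simps)
  show 1: "p \<in> J \<Longrightarrow> q \<in> J \<Longrightarrow> p + q \<in> J" for p q 
    using additive_subgroup.a_closed[OF additive_subgroup_axioms, of p q] by (simp add: mpoly_algebra_simps)
  show 2: "p \<in> J \<Longrightarrow> r \<in> carrier (mpoly_algebra V) \<Longrightarrow> p * r \<in> J" for p r
    using I_r_closed[of p r] by (simp add: mpoly_algebra_simps)
  show 3: "p \<in> J \<Longrightarrow> - p \<in> J" for p
    using 2[OF _ pconst_in_carrier[of "-1"], of p]
    by (simp add: pconst_def single_uminus)
  show "p \<in> J \<Longrightarrow> q \<in> J \<Longrightarrow> p - q \<in> J" using 1[OF _ 3, of p q] by simp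
qed

lemma mpoly_ideal_sum:
  assumes "ideal J (mpoly_algebra V)" "\<And>x. x \<in> A \<Longrightarrow> g x \<in> J"
  shows "(\<Sum>x\<in>A. g x) \<in> J"
  using assms(2) mpoly_ideal_0[OF assms(1)]
  by (induction A rule: infinite_finite_induct) (simp_all add: mpoly_ideal_add[OF assms(1)])

lemma mpoly_ideal_prod_superset:
  assumes "ideal J (mpoly_algebra V)" "finite S" "T \<subseteq> S"
    and "\<And>x. x \<in> S \<Longrightarrow> g x \<in> carrier (mpoly_algebra V)"
    and "(\<Prod>x\<in>T. g x) \<in> J"
  shows "(\<Prod>x\<in>S. g x) \<in> J"
proof -
  have "(\<Prod>x\<in>S. g x) = (\<Prod>x\<in>T. g x) * (\<Prod>x\<in>S - T. g x)"
    using assms(2,3) by (metis mult.commute prod.subset_diff)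
  then show ?thesis
    using mpoly_ideal_mult[OF assms(1,5) mpoly_prod_closed, of "S - T" g] assms(4) by simp
qed

lemma quot_mpoly_algebra_isomorphic:
  assumes S: "S \<subseteq> carrier (mpoly_algebra V)" and T: "T \<subseteq> carrier (mpoly_algebra W)"
    and J: "J = Idl\<^bsub>mpoly_algebra V\<^esub> S" and K: "K = Idl\<^bsub>mpoly_algebra W\<^esub> T"
    and f: "\<And>v. v \<in> V \<Longrightarrow> f v \<in> carrier (mpoly_algebra W)"
    and g: "\<And>w. w \<in> W \<Longrightarrow> g w \<in> carrier (mpoly_algebra V)"
    and fS: "\<And>s. s \<in> S \<Longrightarrow> msubst f s \<in> K"
    and gT: "\<And>t. t \<in> T \<Longrightarrow> msubst g t \<in> J"
    and gf: "\<And>v. v \<in> V \<Longrightarrow> msubst g (f v) - pvar v \<in> J"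
    and fg: "\<And>w. w \<in> W \<Longrightarrow> msubst f (g w) - pvar w \<in> K"
  shows "algebra_isomorphic (quot_algebra (mpoly_algebra V) J) (quot_algebra (mpoly_algebra W) K)"
proof -
  let ?A = "mpoly_algebra V" and ?B = "mpoly_algebra W"
  interpret A: cring ?A by (rule cring_mpoly_algebra)
  interpret B: cring ?B by (rule cring_mpoly_algebra)
  have idJ: "ideal J ?A" and idK: "ideal K ?B"
    unfolding J K using A.genideal_ideal[OF S] B.genideal_ideal[OF T] .
  interpret F: ring_hom_ring ?A ?B "msubst f"
    using f msubst_ring_hom A.ring_axioms B.ring_axioms by (intro ring_hom_ringI2) blast+
  interpret G: ring_hom_ring ?B ?A "msubst g"
    using g msubst_ring_hom A.ring_axioms B.ring_axioms by (intro ring_hom_ringI2) blast+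
  have fJ: "msubst f p \<in> K" if "p \<in> J" for p
  proof -
    have "J \<subseteq> {r \<in> carrier ?A. msubst f r \<in> K}"
      unfolding J using S fS by (intro A.genideal_minimal F.ideal_vimage idK) auto
    with that show ?thesis by blast
  qed
  have gK: "msubst g q \<in> J" if "q \<in> K" for q
  proof -
    have "K \<subseteq> {r \<in> carrier ?B. msubst g r \<in> J}"
      unfolding K using T gT by (intro B.genideal_minimal G.ideal_vimage idJ) auto
    with that show ?thesis by blast
  qed
  have inverse: "msubst k (msubst h p) - p \<in> I"
    if I: "ideal I (mpoly_algebra U)" and p: "p \<in> carrier (mpoly_algebra U)"
      and hk: "\<And>u. u \<in> U \<Longrightarrow> msubst k (h u) - pvar u \<in> I"
      and closed: "\<And>p. p \<in> carrier (mpoly_algebra U) \<Longrightarrow>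
        msubst k (msubst h p) \<in> carrier (mpoly_algebra U)"
    for h :: "'c \<Rightarrow> 'd mpoly" and k :: "'d \<Rightarrow> 'c mpoly" and U I p
    using p
  proof (induction rule: mpoly_algebra_induct)
    case (add p q)
    then have "(msubst k (msubst h p) - p) + (msubst k (msubst h q) - q) \<in> I"
      by (intro mpoly_ideal_add[OF I])
    then show ?case by (simp add: msubst_add algebra_simps)
  next
    case (mult p q)
    then have "(msubst k (msubst h p) - p) * msubst k (msubst h q)
        + (msubst k (msubst h q) - q) * p \<in> I"
      using closed by (intro mpoly_ideal_add[OF I] mpoly_ideal_mult[OF I])
    then show ?case by (simp add: msubst_mult algebra_simps)
  qed (simp_all add: hk mpoly_ideal_0[OF I])
  have gf': "msubst g (msubst f p) - p \<in> J" if "p \<in> carrier ?A" for p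
    using inverse[OF idJ that gf] by simp
  have fg': "msubst f (msubst g q) - q \<in> K" if "q \<in> carrier ?B" for q
    using inverse[OF idK that fg] by simp
  interpret K: ideal K ?B by (rule idK)
  interpret J: ideal J ?A by (rule idJ)
  define h where "h p = K +>\<^bsub>?B\<^esub> msubst f p" for p
  have h_eq: "h p = K +>\<^bsub>?B\<^esub> q \<longleftrightarrow> msubst f p - q \<in> K"
    if "p \<in> carrier ?A" "q \<in> carrier ?B" for p q
  proof -
    have "msubst f p \<ominus>\<^bsub>?B\<^esub> q = msubst f p - q"
    proof -
      have "\<ominus>\<^bsub>?B\<^esub> q = - q"
        using that mpoly_uminus_closed[of q W]
        by (intro B.minus_equality) (simp_all add: mpoly_algebra_simps)
      then show ?thesis by (simp add: a_minus_def mpoly_algebra_simps)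
    qed
    then show ?thesis
      unfolding h_def using B.quotient_eq_iff_same_a_r_cos[OF idK F.hom_closed[OF that(1)] that(2)]
      by auto
  qed
  interpret H: ring_hom_ring ?A "?B Quot K" h
  proof (rule ring_hom_ringI2[OF A.ring_axioms K.quotient_is_ring])
    show "h \<in> ring_hom ?A (?B Quot K)"
      using ring_hom_trans[OF F.homh K.rcos_ring_hom] by (simp add: h_def[abs_def] comp_def)
  qed
  have kernel: "a_kernel ?A (?B Quot K) h = J"
  proof -
    have "h p = \<zero>\<^bsub>?B Quot K\<^esub> \<longleftrightarrow> p \<in> J" if p: "p \<in> carrier ?A" for p
    proof -
      have "\<zero>\<^bsub>?B Quot K\<^esub> = K +>\<^bsub>?B\<^esub> 0"
        using B.a_rcos_zero[OF idK mpoly_ideal_0[OF idK]] by (simp add: FactRing_def)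
      then have "h p = \<zero>\<^bsub>?B Quot K\<^esub> \<longleftrightarrow> msubst f p \<in> K"
        using h_eq[OF p, of 0] pconst_in_carrier[of 0 W] by simp
      also have "\<dots> \<longleftrightarrow> p \<in> J"
        using fJ gK mpoly_ideal_diff[OF idJ _ gf'[OF p], of "msubst g (msubst f p)"] by auto
      finally show ?thesis .
    qed
    then show ?thesis
      using mpoly_ideal_carrier[OF idJ] unfolding a_kernel_def' by blast
  qed
  have "h ` carrier ?A = carrier (?B Quot K)"
  proof
    show "carrier (?B Quot K) \<subseteq> h ` carrier ?A"
    proof
      fix X assume "X \<in> carrier (?B Quot K)"
      then obtain q where q: "q \<in> carrier ?B" "X = K +>\<^bsub>?B\<^esub> q"
        by (auto simp: FactRing_def A_RCOSETS_def')
      then have "X = h (msubst g q)" using h_eq[of "msubst g q" q] fg' by simp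
      then show "X \<in> h ` carrier ?A" using G.hom_closed[OF q(1)] by (rule image_eqI)
    qed
  qed auto
  from H.FactRing_iso_set[OF this]
  have iso: "(\<lambda>X. the_elem (h ` X)) \<in> ring_iso (?A Quot J) (?B Quot K)"
    unfolding kernel .
  have val: "the_elem (h ` (J +>\<^bsub>?A\<^esub> p)) = h p" if "p \<in> carrier ?A" for p
    using H.the_elem_simp[OF that] unfolding kernel .
  show ?thesis unfolding algebra_isomorphic_def
  proof (intro bexI allI ballI)
    show "(\<lambda>X. the_elem (h ` X)) \<in> ring_iso (quot_algebra ?A J) (quot_algebra ?B K)"
      using iso by (simp add: ring_iso_def ring_hom_def quot_algebra_simps)
    fix c X assume "X \<in> carrier (quot_algebra ?A J)"
    then obtain p where p: "p \<in> carrier ?A" "X = J +>\<^bsub>?A\<^esub> p"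
      by (auto simp: quot_algebra_simps FactRing_def A_RCOSETS_def')
    have cp: "pconst c * p \<in> carrier ?A"
      using p(1) pconst_in_carrier by (intro mpoly_mult_closed)
    have "c \<odot>\<^bsub>quot_algebra ?B K\<^esub> h p = h (pconst c * p)"
      unfolding h_def using smult_quot_mpoly_algebra[OF idK F.hom_closed[OF p(1)]]
      by (simp add: mpoly_algebra_simps msubst_mult)
    moreover have "c \<odot>\<^bsub>quot_algebra ?A J\<^esub> X = J +>\<^bsub>?A\<^esub> (pconst c * p)"
      unfolding p(2) smult_quot_mpoly_algebra[OF idJ p(1)] by (simp add: mpoly_algebra_simps)
    ultimately show "the_elem (h ` (c \<odot>\<^bsub>quot_algebra ?A J\<^esub> X)) =
        c \<odot>\<^bsub>quot_algebra ?B K\<^esub> the_elem (h ` X)"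
      unfolding p(2) using val[OF p(1)] val[OF cp] by simp
  qed
qed

lemma (in ring) Idl_Un:
  assumes "S \<subseteq> carrier R" "T \<subseteq> carrier R"
  shows "Idl S <+> Idl T = Idl (S \<union> T)"
proof -
  note ideals = genideal_ideal[OF assms(1)] genideal_ideal[OF assms(2)]
  have "S \<union> T \<subseteq> carrier R" using assms by blast
  note Un = genideal_ideal[OF this] genideal_self[OF this]
  have "Idl S \<union> Idl T \<subseteq> carrier R"
    using genideal_minimal[OF oneideal assms(1)] genideal_minimal[OF oneideal assms(2)] by blast
  note Un_Idl = genideal_ideal[OF this] genideal_self[OF this]
  have "Idl (S \<union> T) = Idl (Idl S \<union> Idl T)"
  proof
    have "S \<union> T \<subseteq> Idl (Idl S \<union> Idl T)"
      using genideal_self[OF assms(1)] genideal_self[OF assms(2)] Un_Idl(2) by blast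
    then show "Idl (S \<union> T) \<subseteq> Idl (Idl S \<union> Idl T)"
      by (rule genideal_minimal[OF Un_Idl(1)])
    have "Idl S \<subseteq> Idl (S \<union> T)" "Idl T \<subseteq> Idl (S \<union> T)"
      using Un(2) by (auto intro: genideal_minimal[OF Un(1), THEN subsetD])
    then show "Idl (Idl S \<union> Idl T) \<subseteq> Idl (S \<union> T)"
      by (intro genideal_minimal[OF Un(1)]) (rule Un_least)
  qed
  then show ?thesis using union_genideal[OF ideals] by simp
qed

section \<open>The two presentations\<close>

context matroid
begin

lemma dependent_in_closure:
  assumes "T \<subseteq> E" "T \<notin> Ind"
  obtains i where "i \<in> T" "i \<in> mcl E Ind (T - {i})"
proof -
  obtain B where B: "B \<in> Ind" "B \<subseteq> T" "card B = mrank Ind T" by (rule mrank_witness)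
  then have "B \<noteq> T" using assms(2) by blast
  then obtain i where i: "i \<in> T" "i \<notin> B" using B(2) by blast
  then have "card B \<le> mrank Ind (T - {i})" using B by (intro card_le_mrank) auto
  then have "mrank Ind (insert i (T - {i})) = mrank Ind (T - {i})"
    using B mrank_mono[of "T - {i}" T] i by (simp add: insert_absorb)
  then show thesis using that i assms(1) by (auto simp: mcl_def)
qed

lemma sup_AL_upper:
  assumes "T \<subseteq> carrier AL" "x \<in> T"
  shows "aug_le E Ind x (\<Squnion>\<^bsub>AL\<^esub>T)"
proof -
  interpret complete_lattice AL by (rule complete_lattice_AL)
  show ?thesis using sup_upper[OF assms(1,2)] by simp
qed

lemma sup_AL_least:
  assumes "T \<subseteq> carrier AL" "z \<in> carrier AL" "\<And>x. x \<in> T \<Longrightarrow> aug_le E Ind x z"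
  shows "aug_le E Ind (\<Squnion>\<^bsub>AL\<^esub>T) z"
proof -
  interpret complete_lattice AL by (rule complete_lattice_AL)
  show ?thesis using sup_least[OF assms(1), of z] assms(2,3) by (simp add: Upper_def)
qed

lemma sup_AL_closed: "T \<subseteq> carrier AL \<Longrightarrow> \<Squnion>\<^bsub>AL\<^esub>T \<in> carrier AL"
proof -
  assume T: "T \<subseteq> carrier AL"
  interpret complete_lattice AL by (rule complete_lattice_AL)
  show ?thesis using sup_closed[OF T] .
qed

lemma sup_AL_Flat:
  assumes "T \<subseteq> carrier AL" "Flat F \<in> T"
  shows "\<Squnion>\<^bsub>AL\<^esub>T \<in> Flat ` flats E Ind"
  using sup_AL_upper[OF assms] sup_AL_closed[OF assms(1)] by (auto simp: aug_le_simps)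

lemma aug_building_set_carrier:
  "loopless E Ind \<Longrightarrow> aug_building_set E Ind \<subseteq> carrier AL"
  by (auto simp: aug_building_set_def loopless_def)

lemma not_nested_Flat:
  assumes "loopless E Ind" "F \<in> flats E Ind" "x \<in> aug_building_set E Ind"
    and "\<not> aug_le E Ind x (Flat F)" "\<not> aug_le E Ind (Flat F) x"
  shows "\<not> nested_set AL (aug_building_set E Ind) {x, Flat F}"
proof -
  have "{x, Flat F} \<subseteq> carrier AL"
    using assms(2,3) aug_building_set_carrier[OF assms(1)] by auto
  then have "\<Squnion>\<^bsub>AL\<^esub>{x, Flat F} \<in> aug_building_set E Ind"
    using sup_AL_Flat[of "{x, Flat F}" F] by (auto simp: aug_building_set_def)
  moreover have "x \<noteq> Flat F" using assms(2,4) by (auto simp: aug_le_simps)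
  ultimately show ?thesis
    using assms(4,5) unfolding nested_set_def AL_simps by (auto intro!: exI[of _ "{x, Flat F}"])
qed

lemma not_nested_cases:
  assumes "loopless E Ind" "finite S" "S \<subseteq> aug_building_set E Ind"
    and "\<not> nested_set AL (aug_building_set E Ind) S"
  obtains (flats) F G where "Flat F \<in> S" "Flat G \<in> S" "F \<in> flats E Ind" "G \<in> flats E Ind"
      "\<not> F \<subseteq> G" "\<not> G \<subseteq> F"
  | (mixed) i F where "Indep {i} \<in> S" "Flat F \<in> S" "i \<in> E" "F \<in> flats E Ind" "i \<notin> F"
  | (dependent) T where "(\<lambda>i. Indep {i}) ` T \<subseteq> S" "T \<subseteq> E" "T \<notin> Ind"
proof -
  from assms(2-4) obtain T where T: "T \<subseteq> S" "card T \<ge> 2"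
    "\<And>x y. x \<in> T \<Longrightarrow> y \<in> T \<Longrightarrow> x \<noteq> y \<Longrightarrow> \<not> aug_le E Ind x y"
    "\<Squnion>\<^bsub>AL\<^esub>T \<in> aug_building_set E Ind"
    unfolding nested_set_def AL_simps by blast
  have TC: "T \<subseteq> carrier AL"
    using T(1) assms(3) aug_building_set_carrier[OF assms(1)] by blast
  show thesis
  proof (cases "\<exists>F. Flat F \<in> T")
    case True
    then obtain F where F: "Flat F \<in> T" ..
    then have FE: "F \<in> flats E Ind" using TC by auto
    have "\<not> T \<subseteq> {Flat F}" using T(2) card_mono[of "{Flat F}" T] by auto
    then obtain x where x: "x \<in> T" "x \<noteq> Flat F" by blast
    then consider i where "x = Indep {i}" "i \<in> E" | G where "x = Flat G" "G \<in> flats E Ind"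
      using T(1) assms(3) unfolding aug_building_set_def by blast
    then show thesis
    proof cases
      case 1
      then have "\<not> i \<in> F"
        using T(3)[OF x(1) F x(2)] FE assms(1) by (auto simp: aug_le_simps loopless_def)
      then show thesis using mixed[of i F] 1 x F T(1) FE by blast
    next
      case 2
      then show thesis
        using flats[of F G] T(1) T(3)[OF x(1) F x(2)] T(3)[OF F x(1) x(2)[symmetric]] FE x F
        by (auto simp: aug_le_simps)
    qed
  next
    case False
    define D where "D = {i. Indep {i} \<in> T}"
    have TD: "T = (\<lambda>i. Indep {i}) ` D" and DE: "D \<subseteq> E"
      using False T(1) assms(3) unfolding D_def aug_building_set_def by blast+
    have "D \<notin> Ind"
    proof
      assume D: "D \<in> Ind"
      have "aug_le E Ind (\<Squnion>\<^bsub>AL\<^esub>T) (Indep D)"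
      proof (rule sup_AL_least[OF TC])
        fix x assume "x \<in> T"
        then show "aug_le E Ind x (Indep D)"
          using D TC by (auto simp: TD aug_le_simps)
      qed (use D in auto)
      then obtain k where k: "\<Squnion>\<^bsub>AL\<^esub>T = Indep {k}"
        using T(4) by (auto simp: aug_building_set_def aug_le_simps)
      have "aug_le E Ind (Indep {i}) (Indep {k})" if "i \<in> D" for i
        using sup_AL_upper[OF TC, of "Indep {i}"] that unfolding k by (simp add: TD)
      then have "D \<subseteq> {k}" by (auto simp: aug_le_simps)
      then have "T \<subseteq> {Indep {k}}" by (auto simp: TD)
      then show False using T(2) card_mono[of "{Indep {k}}" T] by auto
    qed
    then show thesis using dependent[of D] DE T(1) TD by blast
  qed
qed

abbreviation (input) "proper_flats \<equiv> flats E Ind - {E}"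
abbreviation (input) "fy_alg \<equiv> mpoly_algebra (aug_building_set E Ind)"
abbreviation (input) "aug_alg \<equiv> mpoly_algebra (XVar ` proper_flats \<union> YVar ` E)"

definition aug_relations :: "'a aug_var mpoly set" where
  "aug_relations =
     {pvar (XVar F) * pvar (XVar G) | F G.
        F \<in> proper_flats \<and> G \<in> proper_flats \<and> \<not> F \<subseteq> G \<and> \<not> G \<subseteq> F} \<union>
     {pvar (YVar i) * pvar (XVar F) | i F. i \<in> E \<and> F \<in> proper_flats \<and> i \<notin> F} \<union>
     {pvar (YVar i) - (\<Sum>F\<in>{F \<in> proper_flats. i \<notin> F}. pvar (XVar F)) | i. i \<in> E}"

definition aug_ideal :: "'a aug_var mpoly set" where
  "aug_ideal = Idl\<^bsub>aug_alg\<^esub> aug_relations"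

definition fy_relations :: "'a aug_elem mpoly set" where
  "fy_relations = fy_monomial_relations AL (aug_building_set E Ind) \<union>
     fy_linear_relations AL (aug_building_set E Ind)"

definition fy_ideal :: "'a aug_elem mpoly set" where
  "fy_ideal = Idl\<^bsub>fy_alg\<^esub> fy_relations"

fun to_aug :: "'a aug_elem \<Rightarrow> 'a aug_var mpoly" where
  "to_aug (Indep I) = pvar (YVar (the_elem I))"
| "to_aug (Flat F) = (if F = E then - (\<Sum>G\<in>proper_flats. pvar (XVar G)) else pvar (XVar F))"

fun to_fy :: "'a aug_var \<Rightarrow> 'a aug_elem mpoly" where
  "to_fy (XVar F) = pvar (Flat F)"
| "to_fy (YVar i) = pvar (Indep {i})"

lemma pvar_aug_closed:
  "F \<in> proper_flats \<Longrightarrow> pvar (XVar F) \<in> carrier aug_alg"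
  "i \<in> E \<Longrightarrow> pvar (YVar i) \<in> carrier aug_alg"
  by (auto intro: pvar_in_carrier)

lemma pvar_fy_closed:
  "F \<in> flats E Ind \<Longrightarrow> pvar (Flat F) \<in> carrier fy_alg"
  "i \<in> E \<Longrightarrow> pvar (Indep {i}) \<in> carrier fy_alg"
  by (auto intro: pvar_in_carrier simp: aug_building_set_def)

lemma to_aug_closed:
  assumes "v \<in> aug_building_set E Ind"
  shows "to_aug v \<in> carrier aug_alg"
proof -
  have sum: "- (\<Sum>F\<in>proper_flats. pvar (XVar F)) \<in> carrier aug_alg"
    by (intro mpoly_uminus_closed mpoly_sum_closed pvar_aug_closed)
  from assms consider i where "v = Indep {i}" "i \<in> E" | F where "v = Flat F" "F \<in> flats E Ind"
    unfolding aug_building_set_def by blast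
  then show ?thesis using sum pvar_aug_closed by cases simp_all
qed

lemma to_fy_closed:
  "w \<in> XVar ` proper_flats \<union> YVar ` E \<Longrightarrow> to_fy w \<in> carrier fy_alg"
  by (auto intro: pvar_fy_closed)

lemma aug_relations_parts_closed:
  "{pvar (XVar F) * pvar (XVar G) | F G.
     F \<in> proper_flats \<and> G \<in> proper_flats \<and> \<not> F \<subseteq> G \<and> \<not> G \<subseteq> F} \<subseteq> carrier aug_alg"
  "{pvar (YVar i) * pvar (XVar F) | i F. i \<in> E \<and> F \<in> proper_flats \<and> i \<notin> F} \<subseteq> carrier aug_alg"
  "{pvar (YVar i) - (\<Sum>F\<in>{F \<in> proper_flats. i \<notin> F}. pvar (XVar F)) | i. i \<in> E} \<subseteq> carrier aug_alg"
proof -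
  have "pvar (YVar i) - (\<Sum>F\<in>{F \<in> proper_flats. i \<notin> F}. pvar (XVar F)) \<in> carrier aug_alg"
    if "i \<in> E" for i
    using that by (intro mpoly_diff_closed mpoly_sum_closed pvar_aug_closed) auto
  then show "{pvar (YVar i) - (\<Sum>F\<in>{F \<in> proper_flats. i \<notin> F}. pvar (XVar F)) | i. i \<in> E}
      \<subseteq> carrier aug_alg"
    by blast
qed (auto intro!: mpoly_mult_closed pvar_aug_closed)

lemma aug_relations_closed: "aug_relations \<subseteq> carrier aug_alg"
  unfolding aug_relations_def using aug_relations_parts_closed by (intro Un_least)

lemma fy_relations_parts_closed:
  "fy_monomial_relations AL (aug_building_set E Ind) \<subseteq> carrier fy_alg"
  "fy_linear_relations AL (aug_building_set E Ind) \<subseteq> carrier fy_alg"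
proof -
  have "(\<Prod>G\<in>S. pvar G) \<in> carrier fy_alg" if "S \<subseteq> aug_building_set E Ind" for S
    using that by (intro mpoly_prod_closed pvar_in_carrier) blast
  then show "fy_monomial_relations AL (aug_building_set E Ind) \<subseteq> carrier fy_alg"
    unfolding fy_monomial_relations_def by blast
  have "(\<Sum>G\<in>{G \<in> aug_building_set E Ind. H \<sqsubseteq>\<^bsub>AL\<^esub> G}. pvar G) \<in> carrier fy_alg" for H
    by (intro mpoly_sum_closed pvar_in_carrier) blast
  then show "fy_linear_relations AL (aug_building_set E Ind) \<subseteq> carrier fy_alg"
    unfolding fy_linear_relations_def by blast
qed

lemma fy_relations_closed: "fy_relations \<subseteq> carrier fy_alg"
  unfolding fy_relations_def using fy_relations_parts_closed by (intro Un_least)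

lemma aug_chow_ring_eq: "aug_chow_ring E Ind = quot_algebra aug_alg aug_ideal"
proof -
  interpret cring aug_alg by (rule cring_mpoly_algebra)
  show ?thesis
    unfolding aug_chow_ring_def Let_def aug_ideal_def aug_relations_def
    by (simp only: Idl_Un aug_relations_parts_closed Un_subset_iff simp_thms)
qed

lemma fy_chow_ring_eq:
  "fy_chow_ring AL (aug_building_set E Ind) = quot_algebra fy_alg fy_ideal"
proof -
  interpret cring fy_alg by (rule cring_mpoly_algebra)
  show ?thesis
    unfolding fy_chow_ring_def Let_def fy_ideal_def fy_relations_def
    by (simp only: Idl_Un fy_relations_parts_closed)
qed

lemma ideal_aug_ideal: "ideal aug_ideal aug_alg"
  unfolding aug_ideal_def using cring_mpoly_algebra aug_relations_closed
  by (intro ring.genideal_ideal cring.axioms)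

lemma ideal_fy_ideal: "ideal fy_ideal fy_alg"
  unfolding fy_ideal_def using cring_mpoly_algebra fy_relations_closed
  by (intro ring.genideal_ideal cring.axioms)

lemma aug_relations_in_ideal: "aug_relations \<subseteq> aug_ideal"
  unfolding aug_ideal_def using cring_mpoly_algebra aug_relations_closed
  by (intro ring.genideal_self cring.axioms)

lemma fy_relations_in_ideal: "fy_relations \<subseteq> fy_ideal"
  unfolding fy_ideal_def using cring_mpoly_algebra fy_relations_closed
  by (intro ring.genideal_self cring.axioms)

lemma aug_ideal_XX:
  "F \<in> proper_flats \<Longrightarrow> G \<in> proper_flats \<Longrightarrow> \<not> F \<subseteq> G \<Longrightarrow> \<not> G \<subseteq> F \<Longrightarrow>
   pvar (XVar F) * pvar (XVar G) \<in> aug_ideal"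
  by (rule subsetD[OF aug_relations_in_ideal]) (unfold aug_relations_def, blast)

lemma aug_ideal_YX:
  "i \<in> E \<Longrightarrow> F \<in> proper_flats \<Longrightarrow> i \<notin> F \<Longrightarrow> pvar (YVar i) * pvar (XVar F) \<in> aug_ideal"
  by (rule subsetD[OF aug_relations_in_ideal]) (unfold aug_relations_def, blast)

lemma aug_ideal_linear:
  "i \<in> E \<Longrightarrow> pvar (YVar i) - (\<Sum>F\<in>{F \<in> proper_flats. i \<notin> F}. pvar (XVar F)) \<in> aug_ideal"
  by (rule subsetD[OF aug_relations_in_ideal]) (unfold aug_relations_def, blast)

text \<open>If \<open>i\<close> lies in the closure of \<open>T - {i}\<close>, then every flat avoiding \<open>i\<close> avoids some
  \<open>j \<in> T - {i}\<close>, so all terms of \<open>y\<^sub>i = (\<Sum>F\<in>{F. i \<notin> F}. x\<^sub>F)\<close> are killed by the other factors.\<close>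

lemma aug_ideal_dependent:
  assumes "T \<subseteq> E" "T \<notin> Ind"
  shows "(\<Prod>i\<in>T. pvar (YVar i)) \<in> aug_ideal"
proof -
  note aug = ideal_aug_ideal
  obtain i where i: "i \<in> T" "i \<in> mcl E Ind (T - {i})" using assms by (rule dependent_in_closure)
  have fin: "finite T" using assms(1) finite_ground by (rule finite_subset)
  let ?Y = "\<Prod>j\<in>T - {i}. pvar (YVar j) :: 'a aug_var mpoly"
  let ?X = "\<Sum>F\<in>{F \<in> proper_flats. i \<notin> F}. pvar (XVar F) :: 'a aug_var mpoly"
  have Y: "?Y \<in> carrier aug_alg"
    using assms(1) by (intro mpoly_prod_closed pvar_aug_closed) auto
  have "?Y * pvar (XVar F) \<in> aug_ideal" if F: "F \<in> proper_flats" "i \<notin> F" for F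
  proof -
    have "\<not> T - {i} \<subseteq> F" using i(2) F mcl_least by blast
    then obtain j where j: "j \<in> T - {i}" "j \<notin> F" by blast
    have "?Y * pvar (XVar F) =
        (pvar (YVar j) * pvar (XVar F)) * (\<Prod>k\<in>T - {i} - {j}. pvar (YVar k))"
      using prod.remove[OF _ j(1), of "\<lambda>k. pvar (YVar k)"] fin by (simp add: mult_ac)
    moreover have "(pvar (YVar j) * pvar (XVar F)) * (\<Prod>k\<in>T - {i} - {j}. pvar (YVar k)) \<in> aug_ideal"
      using assms(1) j F
      by (intro mpoly_ideal_mult[OF aug] aug_ideal_YX mpoly_prod_closed pvar_aug_closed) auto
    ultimately show ?thesis by simp
  qed
  then have "?Y * ?X \<in> aug_ideal"
    unfolding sum_distrib_left by (intro mpoly_ideal_sum[OF aug]) blast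
  moreover have "(pvar (YVar i) - ?X) * ?Y \<in> aug_ideal"
    using i assms(1) by (intro mpoly_ideal_mult[OF aug] aug_ideal_linear Y) blast
  ultimately have "(pvar (YVar i) - ?X) * ?Y + ?Y * ?X \<in> aug_ideal"
    by (intro mpoly_ideal_add[OF aug])
  also have "(pvar (YVar i) - ?X) * ?Y + ?Y * ?X = (\<Prod>j\<in>T. pvar (YVar j))"
    by (subst prod.remove[OF fin i(1)]) (simp add: algebra_simps)
  finally show ?thesis .
qed

lemma above_Indep:
  assumes "loopless E Ind" "i \<in> E"
  shows "{G \<in> aug_building_set E Ind. Indep {i} \<sqsubseteq>\<^bsub>AL\<^esub> G} =
    insert (Indep {i}) (Flat ` {F \<in> flats E Ind. i \<in> F})"
  using assms by (auto simp: aug_building_set_def aug_le_simps loopless_def)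

lemma above_Flat_empty:
  assumes "loopless E Ind"
  shows "{G \<in> aug_building_set E Ind. Flat {} \<sqsubseteq>\<^bsub>AL\<^esub> G} = Flat ` flats E Ind"
  using empty_in_flats[OF assms] by (auto simp: aug_building_set_def aug_le_simps)

lemma sum_above_Indep:
  assumes "loopless E Ind" "i \<in> E"
  shows "(\<Sum>G\<in>{G \<in> aug_building_set E Ind. Indep {i} \<sqsubseteq>\<^bsub>AL\<^esub> G}. f G) =
    f (Indep {i}) + (\<Sum>F\<in>{F \<in> flats E Ind. i \<in> F}. f (Flat F) :: 'b::comm_monoid_add)"
  unfolding above_Indep[OF assms] using finite_flats
  by (subst sum.insert) (auto simp: sum.reindex inj_on_def)

lemma sum_above_Flat_empty:
  assumes "loopless E Ind"
  shows "(\<Sum>G\<in>{G \<in> aug_building_set E Ind. Flat {} \<sqsubseteq>\<^bsub>AL\<^esub> G}. f G) =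
    (\<Sum>F\<in>flats E Ind. f (Flat F) :: 'b::comm_monoid_add)"
  unfolding above_Flat_empty[OF assms] by (simp add: sum.reindex inj_on_def)

lemma sum_to_aug_flats: "(\<Sum>F\<in>flats E Ind. to_aug (Flat F)) = 0"
  using sum.remove[OF finite_flats ground_in_flats, of "\<lambda>F. to_aug (Flat F)"]
  by simp

lemma sum_flats_split:
  fixes f :: "'a set \<Rightarrow> 'b::comm_monoid_add"
  assumes "i \<in> E"
  shows "(\<Sum>F\<in>flats E Ind. f F) =
    (\<Sum>F\<in>{F \<in> flats E Ind. i \<in> F}. f F) + (\<Sum>F\<in>{F \<in> proper_flats. i \<notin> F}. f F)"
proof -
  have "flats E Ind = {F \<in> flats E Ind. i \<in> F} \<union> {F \<in> proper_flats. i \<notin> F}"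
    using assms by blast
  then have "(\<Sum>F\<in>flats E Ind. f F) =
      (\<Sum>F\<in>{F \<in> flats E Ind. i \<in> F} \<union> {F \<in> proper_flats. i \<notin> F}. f F)"
    by simp
  also have "\<dots> = (\<Sum>F\<in>{F \<in> flats E Ind. i \<in> F}. f F) + (\<Sum>F\<in>{F \<in> proper_flats. i \<notin> F}. f F)"
    using finite_flats by (intro sum.union_disjoint) auto
  finally show ?thesis .
qed

lemma to_aug_linear:
  assumes "loopless E Ind" "p \<in> fy_linear_relations AL (aug_building_set E Ind)"
  shows "msubst to_aug p \<in> aug_ideal"
proof -
  from assms(2) obtain H where H: "H \<in> atoms AL"
    "p = (\<Sum>G\<in>{G \<in> aug_building_set E Ind. H \<sqsubseteq>\<^bsub>AL\<^esub> G}. pvar G)"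
    unfolding fy_linear_relations_def by blast
  from H(1) consider i where "H = Indep {i}" "i \<in> E" | "H = Flat {}"
    unfolding atoms_AL[OF assms(1)] by blast
  then show ?thesis
  proof cases
    case 1
    let ?X = "\<Sum>F\<in>{F \<in> proper_flats. i \<notin> F}. pvar (XVar F) :: 'a aug_var mpoly"
    have "(\<Sum>F\<in>{F \<in> proper_flats. i \<notin> F}. to_aug (Flat F)) = ?X"
      by (intro sum.cong) auto
    then have "(\<Sum>F\<in>{F \<in> flats E Ind. i \<in> F}. to_aug (Flat F)) = - ?X"
      using sum_flats_split[OF 1(2), of "\<lambda>F. to_aug (Flat F)"] sum_to_aug_flats
      by (simp add: eq_neg_iff_add_eq_0 del: to_aug.simps)
    then have "msubst to_aug p = pvar (YVar i) - ?X"
      unfolding H(2) 1(1) sum_above_Indep[OF assms(1) 1(2)] msubst_add msubst_sum msubst_pvar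
      by simp
    then show ?thesis using aug_ideal_linear[OF 1(2)] by simp
  next
    case 2
    then show ?thesis
      unfolding H(2) 2 sum_above_Flat_empty[OF assms(1)] msubst_sum msubst_pvar sum_to_aug_flats
      using mpoly_ideal_0[OF ideal_aug_ideal] by simp
  qed
qed

lemma to_aug_monomial:
  assumes "loopless E Ind" "p \<in> fy_monomial_relations AL (aug_building_set E Ind)"
  shows "msubst to_aug p \<in> aug_ideal"
proof -
  from assms(2) obtain S where S: "p = (\<Prod>G\<in>S. pvar G)" "finite S"
    "S \<subseteq> aug_building_set E Ind" "\<not> nested_set AL (aug_building_set E Ind) S"
    unfolding fy_monomial_relations_def by blast
  have "\<exists>T\<subseteq>S. (\<Prod>G\<in>T. to_aug G) \<in> aug_ideal"
    using assms(1) S(2-4)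
  proof (cases rule: not_nested_cases)
    case (flats F G)
    then have "F \<in> proper_flats" "G \<in> proper_flats" by (auto simp: flats_def)
    then have "(\<Prod>G\<in>{Flat F, Flat G}. to_aug G) \<in> aug_ideal"
      using flats aug_ideal_XX[of F G] by auto
    with flats show ?thesis by (intro exI[of _ "{Flat F, Flat G}"]) blast
  next
    case (mixed i F)
    then have "F \<in> proper_flats" by blast
    then have "(\<Prod>G\<in>{Indep {i}, Flat F}. to_aug G) \<in> aug_ideal"
      using mixed aug_ideal_YX[of i F] by auto
    with mixed show ?thesis by (intro exI[of _ "{Indep {i}, Flat F}"]) blast
  next
    case (dependent T)
    have "(\<Prod>G\<in>(\<lambda>i. Indep {i}) ` T. to_aug G) = (\<Prod>i\<in>T. pvar (YVar i))"
      by (subst prod.reindex) (auto simp: inj_on_def)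
    then show ?thesis
      using dependent aug_ideal_dependent[of T]
      by (intro exI[of _ "(\<lambda>i. Indep {i}) ` T"]) simp
  qed
  then obtain T where "T \<subseteq> S" "(\<Prod>G\<in>T. to_aug G) \<in> aug_ideal" by blast
  then have "(\<Prod>G\<in>S. to_aug G) \<in> aug_ideal"
    using S(2,3) to_aug_closed
    by (intro mpoly_ideal_prod_superset[OF ideal_aug_ideal, of S T]) blast+
  then show ?thesis by (simp add: S(1) msubst_prod)
qed

lemma fy_ideal_not_nested:
  assumes "finite S" "S \<subseteq> aug_building_set E Ind"
    "\<not> nested_set AL (aug_building_set E Ind) S"
  shows "(\<Prod>G\<in>S. pvar G) \<in> fy_ideal"
  using assms by (intro subsetD[OF fy_relations_in_ideal])
    (unfold fy_relations_def fy_monomial_relations_def, blast)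

lemma fy_ideal_pair:
  assumes "loopless E Ind" "F \<in> flats E Ind" "x \<in> aug_building_set E Ind"
    and "\<not> aug_le E Ind x (Flat F)" "\<not> aug_le E Ind (Flat F) x"
  shows "pvar x * pvar (Flat F) \<in> fy_ideal"
proof -
  have "x \<noteq> Flat F" using assms(2,4) by (auto simp: aug_le_simps)
  moreover have "(\<Prod>G\<in>{x, Flat F}. pvar G) \<in> fy_ideal"
    using assms by (intro fy_ideal_not_nested not_nested_Flat) (auto simp: aug_building_set_def)
  ultimately show ?thesis by simp
qed

lemma fy_ideal_linear:
  assumes "H \<in> atoms AL"
  shows "(\<Sum>G\<in>{G \<in> aug_building_set E Ind. H \<sqsubseteq>\<^bsub>AL\<^esub> G}. pvar G) \<in> fy_ideal"
  using assms by (intro subsetD[OF fy_relations_in_ideal])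
    (unfold fy_relations_def fy_linear_relations_def, blast)

lemma fy_ideal_sum_flats:
  assumes "loopless E Ind"
  shows "(\<Sum>F\<in>flats E Ind. pvar (Flat F)) \<in> fy_ideal"
  using fy_ideal_linear[of "Flat {}"] unfolding sum_above_Flat_empty[OF assms] atoms_AL[OF assms]
  by blast

lemma to_fy_relations:
  assumes "loopless E Ind" "q \<in> aug_relations"
  shows "msubst to_fy q \<in> fy_ideal"
  using assms(2) unfolding aug_relations_def
proof (elim UnE CollectE exE conjE)
  fix F G assume "q = pvar (XVar F) * pvar (XVar G)"
    "F \<in> proper_flats" "G \<in> proper_flats" "\<not> F \<subseteq> G" "\<not> G \<subseteq> F"
  then show ?thesis
    using fy_ideal_pair[OF assms(1), of G "Flat F"]
    by (simp add: msubst_mult aug_le_simps aug_building_set_def)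
next
  fix i F assume "q = pvar (YVar i) * pvar (XVar F)" "i \<in> E" "F \<in> proper_flats" "i \<notin> F"
  then show ?thesis
    using fy_ideal_pair[OF assms(1), of F "Indep {i}"]
    by (simp add: msubst_mult aug_le_simps aug_building_set_def)
next
  fix i assume q: "q = pvar (YVar i) - (\<Sum>F\<in>{F \<in> proper_flats. i \<notin> F}. pvar (XVar F))"
    and i: "i \<in> E"
  have "Indep {i} \<in> atoms AL" using i unfolding atoms_AL[OF assms(1)] by blast
  from fy_ideal_linear[OF this]
  have "pvar (Indep {i}) + (\<Sum>F\<in>{F \<in> flats E Ind. i \<in> F}. pvar (Flat F)) \<in> fy_ideal"
    unfolding sum_above_Indep[OF assms(1) i] .
  from mpoly_ideal_diff[OF ideal_fy_ideal this fy_ideal_sum_flats[OF assms(1)]]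
  show ?thesis
    unfolding q sum_flats_split[OF i] by (simp add: msubst_diff msubst_sum)
qed

lemma to_fy_to_aug:
  assumes "loopless E Ind" "v \<in> aug_building_set E Ind"
  shows "msubst to_fy (to_aug v) - pvar v \<in> fy_ideal"
proof (cases "v = Flat E")
  case True
  have "msubst to_fy (to_aug v) - pvar v = - (\<Sum>F\<in>flats E Ind. pvar (Flat F))"
    unfolding True sum.remove[OF finite_flats ground_in_flats]
    by (simp add: msubst_uminus msubst_sum)
  then show ?thesis
    using mpoly_ideal_uminus[OF ideal_fy_ideal fy_ideal_sum_flats[OF assms(1)]] by simp
next
  case False
  from assms(2) consider i where "v = Indep {i}" | F where "v = Flat F"
    unfolding aug_building_set_def by blast
  then show ?thesis
    using mpoly_ideal_0[OF ideal_fy_ideal] False by cases simp_all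
qed

lemma to_aug_to_fy:
  assumes "w \<in> XVar ` proper_flats \<union> YVar ` E"
  shows "msubst to_aug (to_fy w) - pvar w \<in> aug_ideal"
proof -
  from assms consider i where "w = YVar i" | F where "w = XVar F" "F \<noteq> E" by blast
  then show ?thesis using mpoly_ideal_0[OF ideal_aug_ideal] by cases simp_all
qed

theorem fy_chow_ring_isomorphic_aug_chow_ring:
  assumes "loopless E Ind"
  shows "algebra_isomorphic (fy_chow_ring AL (aug_building_set E Ind)) (aug_chow_ring E Ind)"
  unfolding fy_chow_ring_eq aug_chow_ring_eq
proof (rule quot_mpoly_algebra_isomorphic[where f = to_aug and g = to_fy,
      OF fy_relations_closed aug_relations_closed fy_ideal_def aug_ideal_def])
  show "msubst to_aug s \<in> aug_ideal" if "s \<in> fy_relations" for s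
    using that to_aug_linear to_aug_monomial assms unfolding fy_relations_def by blast
qed (fact to_aug_closed to_fy_closed to_fy_relations[OF assms] to_fy_to_aug[OF assms] to_aug_to_fy)+

end

theorem theorem5p10:
  fixes n :: nat and Ind :: "nat set set"
  assumes "matroid {1..n} Ind"
    and "loopless {1..n} Ind"
  shows "algebra_isomorphic
           (fy_chow_ring (aug_lattice {1..n} Ind) (aug_building_set {1..n} Ind))
           (aug_chow_ring {1..n} Ind)"
  using assms by (rule matroid.fy_chow_ring_isomorphic_aug_chow_ring)

end
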